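(* For every $\epsilon\in(0,1)$ and any sparsity parameter $\phi'$, every $n$-vertex graph $G$ has an $(\epsilon,\phi')$ edge sample set of size $\min\{\Theta(n\frac{\phi'}{\epsilon^2}), n\}$. Further, such a set can be computed by a deterministic algorithm which runs in near-linear time.
   Context: Graphs are finite, connected and undirected, with $n$ vertices and $m$ edges; near-linear time means $\tilde O(m)$, i.e. $O(m)$ up to polylogarithmic factors. $\delta_G(W)$ is the set of edges with exactly one endpoint in $W$, and $\overline W=V(G)\setminus W$. The sparsity of $W$ is $\phi(W)=\frac{|\delta_G(W)|}{\min(|W|,|\overline W|)}$, and for a terminal set $T\subseteq V(G)$ the terminal sparsity is $\phi_T(W)=\frac{|\delta_G(W)|}{\min(|W\cap T|,|\overline W\cap T|)}$ (taken to be $+\infty$ when the denominator is zero). An $(\epsilon,\phi')$ edge sample set for $G$ is a nonempty set $T\subseteq V(G)$ with the following property. Let $W\subseteq V(G)$ be either (a) a connected component after removing an edge cut, or (b) the union of all connected components except one after removing an edge cut. Suppose further that either $\phi(W)\le\phi'$ or $\phi_T(W)\le\frac{n}{|T|}\cdot\frac{\phi'}{10}$. Then $\left|\frac{n}{|T|}|W\cap T|-|W|\right|\le\epsilon|W|$.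
   Formalization: The sparsity parameter φ' is taken positive, and the upper bound on the size is replaced by 1 where the Θ(nφ'/ε²) bound drops below 1, since an edge sample set is nonempty by definition and so cannot have fewer than one element. *)

theory Defs
  imports Complex_Main "HOL-Library.Extended_Real" "HOL-Library.Log_Nat"
begin

section \<open>Graphs, cuts and sparsity\<close>

text \<open>A graph is given by its vertex set and its set of two-element edges.\<close>

definition adj_rel :: "'a set set \<Rightarrow> ('a \<times> 'a) set" where
  "adj_rel F = {(u, v). {u, v} \<in> F}"

definition components :: "'a set \<Rightarrow> 'a set set \<Rightarrow> 'a set set" where
  "components V F = V // {(u, v). u \<in> V \<and> v \<in> V \<and> (u, v) \<in> (adj_rel F)\<^sup>*}"

definition connected_graph :: "'a set \<Rightarrow> 'a set set \<Rightarrow> bool" where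
  "connected_graph V E \<longleftrightarrow>
     finite V \<and> V \<noteq> {} \<and> (\<forall>e\<in>E. e \<subseteq> V \<and> card e = 2) \<and>
     (\<forall>u\<in>V. \<forall>v\<in>V. (u, v) \<in> (adj_rel E)\<^sup>*)"

definition boundary :: "'a set set \<Rightarrow> 'a set \<Rightarrow> 'a set set" where
  "boundary E W = {e \<in> E. card (e \<inter> W) = 1}"

definition is_edge_cut :: "'a set \<Rightarrow> 'a set set \<Rightarrow> 'a set set \<Rightarrow> bool" where
  "is_edge_cut V E C \<longleftrightarrow> (\<exists>S. S \<noteq> {} \<and> S \<subset> V \<and> C = boundary E S)"

definition component_after_cut :: "'a set \<Rightarrow> 'a set set \<Rightarrow> 'a set \<Rightarrow> bool" where
  "component_after_cut V E W \<longleftrightarrow>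
     (\<exists>C. is_edge_cut V E C \<and> W \<in> components V (E - C))"

definition all_but_one_component_after_cut :: "'a set \<Rightarrow> 'a set set \<Rightarrow> 'a set \<Rightarrow> bool" where
  "all_but_one_component_after_cut V E W \<longleftrightarrow>
     (\<exists>C. is_edge_cut V E C \<and>
        (\<exists>K \<in> components V (E - C). W = \<Union> (components V (E - C) - {K})))"

text \<open>In a connected graph, the sets \<open>W\<close> to which the sparsity is applied below are nonempty
  proper subsets of \<open>V\<close>, so its denominator is nonzero there.  The denominator of the terminal
  sparsity can vanish.\<close>

definition sparsity :: "'a set \<Rightarrow> 'a set set \<Rightarrow> 'a set \<Rightarrow> real" where
  "sparsity V E W = real (card (boundary E W)) / real (min (card W) (card (V - W)))"

definition terminal_sparsity :: "'a set \<Rightarrow> 'a set set \<Rightarrow> 'a set \<Rightarrow> 'a set \<Rightarrow> ereal" where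
  "terminal_sparsity V E T W =
     (let d = min (card (W \<inter> T)) (card ((V - W) \<inter> T))
      in if d = 0 then \<infinity> else ereal (real (card (boundary E W)) / real d))"

definition edge_sample_set :: "'a set \<Rightarrow> 'a set set \<Rightarrow> real \<Rightarrow> real \<Rightarrow> 'a set \<Rightarrow> bool" where
  "edge_sample_set V E \<epsilon> \<phi> T \<longleftrightarrow>
     T \<noteq> {} \<and> T \<subseteq> V \<and>
     (\<forall>W. (component_after_cut V E W \<or> all_but_one_component_after_cut V E W) \<longrightarrow>
          (sparsity V E W \<le> \<phi> \<or>
           terminal_sparsity V E T W \<le> ereal (real (card V) / real (card T) * (\<phi> / 10))) \<longrightarrow>
          \<bar>real (card V) / real (card T) * real (card (W \<inter> T)) - real (card W)\<bar>
            \<le> \<epsilon> * real (card W))"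

text \<open>\<open>k\<close> equals \<open>min {y, n}\<close> for some \<open>y\<close> between \<open>c\<^sub>1 * x\<close> and \<open>c\<^sub>2 * x\<close>, where the upper
  bound is replaced by \<open>1\<close> if it drops below \<open>1\<close>: sample sets are nonempty, so no set has
  fewer than one element, however small \<open>x\<close> is.\<close>

definition min_theta_size :: "real \<Rightarrow> real \<Rightarrow> real \<Rightarrow> nat \<Rightarrow> nat \<Rightarrow> bool" where
  "min_theta_size c1 c2 x n k \<longleftrightarrow>
     min (c1 * x) (real n) \<le> real k \<and> real k \<le> min (max 1 (c2 * x)) (real n)"


section \<open>A deterministic random access machine with logarithmic cost\<close>

text \<open>Programs are while programs over finitely many arrays of natural numbers of unbounded
  length; a scalar variable is cell \<open>0\<close> of an array.  The only arithmetic on array contents is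
  addition and truncated subtraction, and every natural number that is read, computed or used as
  an address is charged its binary length (\<open>floorlog 2\<close>).

  Real input parameters are read-only: real values cannot be stored or converted to natural
  numbers.  They only occur in comparisons of arithmetic expressions that are written out in the
  program text; real operations have unit cost.\<close>

type_synonym store = "string \<Rightarrow> nat \<Rightarrow> nat"

type_synonym params = "nat \<Rightarrow> real"

datatype nexp =
    NConst nat
  | NRead string nexp
  | NAdd nexp nexp
  | NSub nexp nexp

datatype rexp =
    RParam nat
  | ROfNat nexp
  | RAdd rexp rexp
  | RSub rexp rexp
  | RMul rexp rexp

datatype bexp =
    NLess nexp nexp
  | RLess rexp rexp
  | BNot bexp
  | BAnd bexp bexp

datatype prog =
    Skip
  | Write string nexp nexp  \<comment> \<open>array, index, value\<close>
  | Seq prog prog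
  | Cond bexp prog prog
  | Loop bexp prog

fun nval :: "store \<Rightarrow> nexp \<Rightarrow> nat" where
  "nval s (NConst k) = k"
| "nval s (NRead x i) = s x (nval s i)"
| "nval s (NAdd a b) = nval s a + nval s b"
| "nval s (NSub a b) = nval s a - nval s b"

fun rval :: "params \<Rightarrow> store \<Rightarrow> rexp \<Rightarrow> real" where
  "rval p s (RParam i) = p i"
| "rval p s (ROfNat a) = real (nval s a)"
| "rval p s (RAdd a b) = rval p s a + rval p s b"
| "rval p s (RSub a b) = rval p s a - rval p s b"
| "rval p s (RMul a b) = rval p s a * rval p s b"

fun bval :: "params \<Rightarrow> store \<Rightarrow> bexp \<Rightarrow> bool" where
  "bval p s (NLess a b) \<longleftrightarrow> nval s a < nval s b"
| "bval p s (RLess a b) \<longleftrightarrow> rval p s a < rval p s b"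
| "bval p s (BNot a) \<longleftrightarrow> \<not> bval p s a"
| "bval p s (BAnd a b) \<longleftrightarrow> bval p s a \<and> bval p s b"

text \<open>Operands and addresses are charged where the corresponding subexpression is evaluated.\<close>

fun ncost :: "store \<Rightarrow> nexp \<Rightarrow> nat" where
  "ncost s (NConst k) = 1 + floorlog 2 k"
| "ncost s (NRead x i) = 1 + ncost s i + floorlog 2 (s x (nval s i))"
| "ncost s (NAdd a b) = 1 + ncost s a + ncost s b + floorlog 2 (nval s a + nval s b)"
| "ncost s (NSub a b) = 1 + ncost s a + ncost s b + floorlog 2 (nval s a - nval s b)"

fun rcost :: "store \<Rightarrow> rexp \<Rightarrow> nat" where
  "rcost s (RParam i) = 1"
| "rcost s (ROfNat a) = 1 + ncost s a"
| "rcost s (RAdd a b) = 1 + rcost s a + rcost s b"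
| "rcost s (RSub a b) = 1 + rcost s a + rcost s b"
| "rcost s (RMul a b) = 1 + rcost s a + rcost s b"

fun bcost :: "store \<Rightarrow> bexp \<Rightarrow> nat" where
  "bcost s (NLess a b) = 1 + ncost s a + ncost s b"
| "bcost s (RLess a b) = 1 + rcost s a + rcost s b"
| "bcost s (BNot a) = 1 + bcost s a"
| "bcost s (BAnd a b) = 1 + bcost s a + bcost s b"

text \<open>\<open>exec p c s t s'\<close>: with real parameters \<open>p\<close>, program \<open>c\<close> started in \<open>s\<close> terminates in \<open>s'\<close>
  at total cost \<open>t\<close>.\<close>

inductive exec :: "params \<Rightarrow> prog \<Rightarrow> store \<Rightarrow> nat \<Rightarrow> store \<Rightarrow> bool" for p where
  Skip: "exec p Skip s 1 s"
| Write: "exec p (Write x i a) s (1 + ncost s i + ncost s a)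
            (s(x := (s x)(nval s i := nval s a)))"
| Seq: "exec p c1 s t1 s1 \<Longrightarrow> exec p c2 s1 t2 s2 \<Longrightarrow> exec p (Seq c1 c2) s (t1 + t2) s2"
| CondTrue: "bval p s b \<Longrightarrow> exec p c1 s t s1 \<Longrightarrow> exec p (Cond b c1 c2) s (1 + bcost s b + t) s1"
| CondFalse: "\<not> bval p s b \<Longrightarrow> exec p c2 s t s1 \<Longrightarrow> exec p (Cond b c1 c2) s (1 + bcost s b + t) s1"
| LoopFalse: "\<not> bval p s b \<Longrightarrow> exec p (Loop b c) s (1 + bcost s b) s"
| LoopTrue: "bval p s b \<Longrightarrow> exec p c s t1 s1 \<Longrightarrow> exec p (Loop b c) s1 t2 s2 \<Longrightarrow>
             exec p (Loop b c) s (1 + bcost s b + t1 + t2) s2"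

inductive_cases exec_SkipE: "exec p Skip s t s'"
inductive_cases exec_WriteE: "exec p (Write x i a) s t s'"
inductive_cases exec_SeqE: "exec p (Seq c1 c2) s t s'"
inductive_cases exec_CondE: "exec p (Cond b c1 c2) s t s'"
inductive_cases exec_LoopE: "exec p (Loop b c) s t s'"

lemma exec_deterministic:
  "exec p c s t s' \<Longrightarrow> exec p c s u s'' \<Longrightarrow> u = t \<and> s'' = s'"
proof (induction arbitrary: u s'' rule: exec.induct)
  case (Skip s)
  then show ?case by (rule exec_SkipE) auto
next
  case (Write x i a s)
  then show ?case by (rule exec_WriteE) auto
next
  case (Seq c1 s t1 s1 c2 t2 s2)
  from Seq.prems show ?case by (rule exec_SeqE) (use Seq.IH in fastforce)+
next
  case (CondTrue s b c1 t s1 c2)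
  from CondTrue.prems show ?case by (rule exec_CondE) (use CondTrue.hyps CondTrue.IH in fastforce)+
next
  case (CondFalse s b c2 t s1 c1)
  from CondFalse.prems show ?case by (rule exec_CondE) (use CondFalse.hyps CondFalse.IH in fastforce)+
next
  case (LoopFalse s b c)
  from LoopFalse.prems show ?case by (rule exec_LoopE) (use LoopFalse.hyps in fastforce)+
next
  case (LoopTrue s b c t1 s1 t2 s2)
  from LoopTrue.prems show ?case by (rule exec_LoopE) (use LoopTrue.hyps LoopTrue.IH in fastforce)+
qed


section \<open>Graph inputs\<close>

text \<open>The vertices of an input graph are \<open>0, \<dots>, n - 1\<close>; its edges are given by one adjacency list
  per vertex, in an arbitrary order.\<close>

definition adjacency_lists :: "nat \<Rightarrow> nat set set \<Rightarrow> nat list list \<Rightarrow> bool" where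
  "adjacency_lists n E ls \<longleftrightarrow>
     length ls = n \<and> (\<forall>v<n. distinct (ls ! v) \<and> set (ls ! v) = {u. {v, u} \<in> E})"

text \<open>The lists are stored consecutively in \<open>adj\<close>; the list of \<open>v\<close> occupies the cells from
  \<open>off v\<close> to \<open>off (v + 1) - 1\<close>.  All other memory is zero.\<close>

definition input_store :: "nat list list \<Rightarrow> store" where
  "input_store ls = (\<lambda>x i.
     if x = ''n'' \<and> i = 0 then length ls
     else if x = ''off'' \<and> i \<le> length ls then length (concat (take i ls))
     else if x = ''adj'' \<and> i < length (concat ls) then concat ls ! i
     else 0)"

definition input_params :: "real \<Rightarrow> real \<Rightarrow> params" where
  "input_params \<epsilon> \<phi> = (\<lambda>i. if i = 0 then \<epsilon> else \<phi>)"

definition output_set :: "nat \<Rightarrow> store \<Rightarrow> nat set" where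
  "output_set n s = {v. v < n \<and> s ''out'' v \<noteq> 0}"

end

theory Submission
  imports Defs
begin

text \<open>List the vertices in depth-first preorder.  The search walks along every edge of its spanning tree
  twice, so along this list membership in a set \<open>W\<close> changes at most \<open>2 |\<delta>(W)|\<close> times.  Let \<open>T\<close> consist of
  \<open>k\<close> evenly spaced entries of the list.  Each maximal run of entries inside \<open>W\<close> is then sampled up to an
  additive error below \<open>n / k\<close>, so the total error is at most \<open>2 (n / k) |\<delta>(W)|\<close>.  For
  \<open>k \<ge> 2 n \<phi> / \<epsilon>\<^sup>2\<close> this is at most \<open>\<epsilon>\<^sup>2 |W|\<close> if \<open>W\<close> has sparsity at most \<open>\<phi>\<close>, and at most
  \<open>\<epsilon>\<^sup>2 / 10\<close> times the estimate \<open>(n / k) |W \<inter> T|\<close> if its terminal sparsity is small.  If that many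
  vertices do not exist, \<open>T = V\<close> has no error.\<close>

section \<open>Evenly spaced samples of a list\<close>

definition changes :: "'a set \<Rightarrow> 'a list \<Rightarrow> nat" where
  "changes W xs = (\<Sum>i<length xs - 1. of_bool ((xs ! i \<in> W) \<noteq> (xs ! Suc i \<in> W)))"

text \<open>As \<open>i\<close> runs from 0 to \<open>n\<close>, the quotient
  \<open>i * k div n\<close> climbs from 0 to \<open>k\<close>; its jumps are evenly spaced. The
  parameter \<open>n\<close> is kept apart from \<open>length xs\<close> so that a prefix can be
  sampled while the list still grows.\<close>

definition picked :: "nat \<Rightarrow> nat \<Rightarrow> 'a list \<Rightarrow> 'a set" where
  "picked k n xs = {xs ! i | i. i < length xs \<and> Suc i * k div n \<noteq> i * k div n}"

lemma changes_snoc: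
  assumes "xs \<noteq> []"
  shows "changes W (xs @ [u]) = changes W xs + of_bool ((last xs \<in> W) \<noteq> (u \<in> W))"
proof -
  obtain N where N: "length xs = Suc N"
    using assms by (cases xs) auto
  have "last xs = xs ! N"
    using assms N by (simp add: last_conv_nth)
  moreover have "(\<Sum>i<N. of_bool (((xs @ [u]) ! i \<in> W) \<noteq> ((xs @ [u]) ! Suc i \<in> W)))
      = (\<Sum>i<N. of_bool ((xs ! i \<in> W) \<noteq> (xs ! Suc i \<in> W)))"
    by (rule sum.cong) (auto simp: nth_append N)
  ultimately show ?thesis
    by (simp add: changes_def N nth_append)
qed

lemma changes_singleton [simp]: "changes W [x] = 0"
  by (simp add: changes_def)

lemma picked_subset: "picked k n xs \<subseteq> set xs"
  by (auto simp: picked_def)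

lemma picked_Nil [simp]: "picked k n [] = {}"
  by (simp add: picked_def)

text \<open>Whether an entry is picked depends on its index alone, so appending never revises
  earlier choices. This is what lets the program select vertices during the search.\<close>

lemma picked_snoc:
  "picked k n (xs @ [u]) =
    picked k n xs \<union> (if Suc (length xs) * k div n \<noteq> length xs * k div n then {u} else {})"
proof -
  have "picked k n (xs @ [u]) = (\<lambda>i. (xs @ [u]) ! i) ` ({i. i < length xs \<and> Suc i * k div n \<noteq> i * k div n} \<union>
      (if Suc (length xs) * k div n \<noteq> length xs * k div n then {length xs} else {}))"
    unfolding picked_def setcompr_eq_image
    by (rule arg_cong[of _ _ "image _"]) (auto simp del: mult_Suc simp: less_Suc_eq)
  also have "\<dots> = picked k n xs \<union>
      (if Suc (length xs) * k div n \<noteq> length xs * k div n then {u} else {})"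
    unfolding image_Un by (rule arg_cong2[of _ _ _ _ "(\<union>)"]) (auto simp: picked_def nth_append simp del: mult_Suc)
  finally show ?thesis .
qed

text \<open>For \<open>k \<le> n\<close>, adding \<open>k\<close> carries at most once. The carry is
  both the jump that defines \<open>picked\<close> and the wrap-around of the program's counter
  \<open>acc\<close>.\<close>

lemma div_step:
  fixes a k n :: nat
  assumes "k \<le> n" "0 < n"
  shows "(a + k) div n = a div n + of_bool (n \<le> a mod n + k)"
    and "(a + k) mod n = a mod n + k - (if n \<le> a mod n + k then n else 0)"
proof -
  define q r where "q = a div n" and "r = a mod n"
  have a: "a = q * n + r" and r: "r < n"
    using assms by (simp_all add: q_def r_def)
  have eq: "m div n = t \<and> m mod n = s" if "m = t * n + s" "s < n" for m t s
    using that by simp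
  have "(a + k) div n = q + of_bool (n \<le> r + k) \<and>
      (a + k) mod n = r + k - (if n \<le> r + k then n else 0)"
  proof (cases "n \<le> r + k")
    case True
    then show ?thesis
      using eq[of "a + k" "q + 1" "r + k - n"] a r assms(1) by simp
  next
    case False
    then show ?thesis
      using eq[of "a + k" q "r + k"] a by simp
  qed
  then show "(a + k) div n = a div n + of_bool (n \<le> a mod n + k)"
    and "(a + k) mod n = a mod n + k - (if n \<le> a mod n + k then n else 0)"
    by (simp_all add: q_def r_def)
qed

text \<open>By \<open>div_step\<close> the quotient grows by 0 or 1, so its increment is the
  indicator of being picked. Written as a difference, it can be telescoped or summed by
  parts.\<close>

lemma card_Int_picked:
  assumes "distinct xs" "k \<le> n" "0 < n"
  shows "int (card (W \<inter> picked k n xs)) = (\<Sum>i<length xs. of_bool (xs ! i \<in> W) *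
      (int (Suc i * k div n) - int (i * k div n)))"
  using assms(1)
proof (induction xs rule: rev_induct)
  case (snoc u xs)
  have fin: "finite (picked k n xs)"
    using picked_subset finite_subset by (metis finite_set)
  have "u \<notin> picked k n xs"
    using snoc.prems picked_subset by fastforce
  moreover have "Suc (length xs) * k div n = length xs * k div n + of_bool (n \<le> length xs * k mod n + k)"
    using div_step(1)[OF assms(2,3), of "length xs * k"] by (simp add: add.commute)
  ultimately show ?case
    using snoc fin by (auto simp: picked_snoc nth_append Int_Un_distrib)
qed simp

lemma card_Int_set_eq_sum:
  assumes "distinct xs"
  shows "card (W \<inter> set xs) = (\<Sum>i<length xs. of_bool (xs ! i \<in> W))"
  using assms
proof (induction xs rule: rev_induct)
  case (snoc u xs)
  then show ?case
    by (auto simp: nth_append Int_Un_distrib card_insert_if Int_insert_right)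
qed simp

lemma card_picked:
  assumes "distinct xs" "length xs = n" "k \<le> n" "0 < n"
  shows "card (picked k n xs) = k"
proof -
  have "int (card (UNIV \<inter> picked k n xs)) = (\<Sum>i<n. int (Suc i * k div n) - int (i * k div n))"
    using card_Int_picked[OF assms(1,3,4), of UNIV] assms(2) by simp
  also have "\<dots> = int k"
    using sum_lessThan_telescope[of "\<lambda>i. int (i * k div n)" n] assms(4) by simp
  finally show ?thesis
    by simp
qed

text \<open>Abel summation. The assumption on \<open>F 0\<close> removes one boundary term;
  \<open>discrepancy_le\<close> chooses \<open>F\<close> so that the other one vanishes as
  well.\<close>

lemma sum_by_parts:
  fixes w F :: "nat \<Rightarrow> int"
  assumes "F 0 = 0"
  shows "(\<Sum>i<Suc N. w i * (F (Suc i) - F i)) =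
    w N * F (Suc N) + (\<Sum>i<N. F (Suc i) * (w i - w (Suc i)))"
  by (induction N) (auto simp: assms algebra_simps)

text \<open>The value \<open>-(i * k mod n)\<close> is the discrepancy accumulated after the first \<open>i\<close> entries.  It lies in
  \<open>(-n, 0]\<close>, so summation by parts charges at most \<open>n\<close> to every change.\<close>

lemma discrepancy_le:
  assumes "distinct xs" "length xs = n" "k \<le> n" "0 < n"
  shows "\<bar>int n * int (card (W \<inter> picked k n xs)) - int k * int (card (W \<inter> set xs))\<bar>
    \<le> int n * int (changes W xs)"
proof -
  obtain N where N: "n = Suc N"
    using assms(4) by (cases n) auto
  define w where "w i = (of_bool (xs ! i \<in> W) :: int)" for i
  define F where "F i = - int (i * k mod n)" for i
  \<comment> \<open>The increment of \<open>F\<close> is the error contributed by one entry of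
    \<open>W\<close>: \<open>n\<close> if it is picked, minus \<open>k\<close>.\<close>
  have F: "F (Suc i) - F i = int n * (int (Suc i * k div n) - int (i * k div n)) - int k" for i
  proof -
    have *: "int (j * k) = int n * int (j * k div n) + int (j * k mod n)" for j
      by (metis mult_div_mod_eq of_nat_add of_nat_mult)
    show ?thesis
      using *[of i] *[of "Suc i"] by (simp add: F_def algebra_simps)
  qed
  have "int n * int (card (W \<inter> picked k n xs)) - int k * int (card (W \<inter> set xs)) =
      (\<Sum>i<Suc N. w i * (F (Suc i) - F i))"
    unfolding card_Int_picked[OF assms(1,3,4)] card_Int_set_eq_sum[OF assms(1)] F assms(2) N[symmetric]
      w_def of_nat_sum sum_distrib_left sum_subtractf[symmetric]
    by (intro sum.cong) (simp_all add: right_diff_distrib mult.left_commute)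
  \<comment> \<open>The boundary term is a multiple of \<open>F n\<close>, which is 0 because
    \<open>n * k mod n = 0\<close>.\<close>
  also have "\<dots> = (\<Sum>i<N. F (Suc i) * (w i - w (Suc i)))"
    by (subst sum_by_parts) (simp_all add: F_def N del: mult_Suc)
  finally have "\<bar>int n * int (card (W \<inter> picked k n xs)) - int k * int (card (W \<inter> set xs))\<bar>
      \<le> (\<Sum>i<N. \<bar>F (Suc i) * (w i - w (Suc i))\<bar>)"
    by simp
  also have "\<dots> \<le> (\<Sum>i<N. int n * of_bool ((xs ! i \<in> W) \<noteq> (xs ! Suc i \<in> W)))"
  proof (rule sum_mono)
    fix i
    have "\<bar>F (Suc i)\<bar> \<le> int n"
      using assms(4) by (simp add: F_def del: mult_Suc of_nat_mod flip: of_nat_mod)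
    then show "\<bar>F (Suc i) * (w i - w (Suc i))\<bar>
        \<le> int n * of_bool ((xs ! i \<in> W) \<noteq> (xs ! Suc i \<in> W))"
      by (simp add: w_def abs_mult)
  qed
  also have "\<dots> = int n * int (changes W xs)"
    by (simp add: changes_def assms(2) N sum_distrib_left)
  finally show ?thesis .
qed

section \<open>Sample sets from vertex orders\<close>

lemma component_after_cut_subset: "component_after_cut V E W \<Longrightarrow> W \<subseteq> V"
  by (auto simp: component_after_cut_def components_def quotient_def)

lemma all_but_one_component_after_cut_subset: "all_but_one_component_after_cut V E W \<Longrightarrow> W \<subseteq> V"
  by (auto simp: all_but_one_component_after_cut_def components_def quotient_def)

lemma boundary_empty [simp]: "boundary {} W = {}"
  by (simp add: boundary_def)

text \<open>The accuracy argument treats every \<open>W \<subseteq> V\<close>, so it also meets the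
  two sets whose \<open>sparsity\<close> has denominator 0.\<close>

lemma boundary_trivial:
  assumes "connected_graph V E" "W = {} \<or> W = V"
  shows "boundary E W = {}"
  using assms by (auto simp: boundary_def connected_graph_def Int_absorb2)

text \<open>The interface between sampling and search: depth-first order enters only through the
  bound on \<open>changes\<close>.\<close>

lemma edge_sample_set_picked:
  fixes \<epsilon> \<phi> :: real
  assumes graph: "connected_graph V E"
    and xs: "distinct xs" "set xs = V"
    and changes: "\<And>W. changes W xs \<le> 2 * card (boundary E W)"
    and eps: "0 < \<epsilon>" "\<epsilon> < 1"
    and k: "0 < k" "k \<le> card V" "k < card V \<Longrightarrow> 2 * real (card V) * \<phi> \<le> real k * \<epsilon>\<^sup>2"
  shows "edge_sample_set V E \<epsilon> \<phi> (picked k (card V) xs)"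
proof -
  define n T where "n = card V" and "T = picked k (card V) xs"
  have n: "length xs = n" "0 < n" "finite V"
    using xs k by (auto simp: n_def distinct_card)
  have T: "card T = k" "T \<subseteq> V"
    using card_picked[of xs n k] picked_subset[of k n xs] n xs k by (auto simp: T_def n_def)
  have accurate: "\<bar>real n / real k * real (card (W \<inter> T)) - real (card W)\<bar> \<le> \<epsilon> * real (card W)"
    if W: "W \<subseteq> V" and sparse: "sparsity V E W \<le> \<phi> \<or>
      terminal_sparsity V E T W \<le> ereal (real n / real k * (\<phi> / 10))" for W
  proof (cases "k = n")
    case True
    then have "T = V"
      using T n by (simp add: card_subset_eq n_def)
    then show ?thesis
      using W True k eps by (simp add: Int_absorb2)
  next
    case False
    define w x D where "w = real (card W)" and "x = real n / real k * real (card (W \<inter> T))"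
      and "D = real (card (boundary E W))"
    have step: "2 * (real n / real k) * \<phi> \<le> \<epsilon>\<^sup>2"
      using k False by (simp add: n_def field_simps)
    have eps2: "\<epsilon>\<^sup>2 \<le> \<epsilon>"
      using eps by (simp add: power2_eq_square mult_le_cancel_left2)
    have nn: "0 \<le> w" "0 \<le> x" "0 \<le> real n / real k"
      by (simp_all add: w_def x_def)
    have disc: "\<bar>x - w\<bar> \<le> 2 * (real n / real k) * D"
    proof -
      have "real_of_int \<bar>int n * int (card (W \<inter> T)) - int k * int (card W)\<bar>
          \<le> real_of_int (int n * int (changes W xs))"
        using discrepancy_le[of xs n k W] n k W xs
        by (simp only: of_int_le_iff T_def n_def Int_absorb2)
      also have "\<dots> \<le> real n * (2 * D)"
        using changes[of W] by (simp add: D_def mult_left_mono)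
      finally have "\<bar>real n * real (card (W \<inter> T)) - real k * w\<bar> \<le> real n * (2 * D)"
        by (simp add: w_def)
      moreover have "real n * real (card (W \<inter> T)) - real k * w = real k * (x - w)"
        using k by (simp add: x_def field_simps)
      ultimately have "real k * \<bar>x - w\<bar> \<le> real n * (2 * D)"
        by (simp add: abs_mult)
      then show ?thesis
        using k by (simp add: field_simps)
    qed
    from sparse have "\<bar>x - w\<bar> \<le> \<epsilon> * w"
    proof
      assume sp: "sparsity V E W \<le> \<phi>"
      have "D \<le> \<phi> * w"
      proof (cases "W = {} \<or> W = V")
        case True
        then have "D = 0"
          using boundary_trivial[OF graph] by (simp add: D_def)
        \<comment> \<open>Here \<open>sparsity\<close> is 0 / 0, which is 0 in HOL, so
          \<open>sp\<close> reveals the sign of \<open>\<phi>\<close>.\<close>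
        moreover have "0 \<le> \<phi>"
          using sp True boundary_trivial[OF graph] by (simp add: sparsity_def)
        ultimately show ?thesis
          using nn by simp
      next
        case False
        then have pos: "0 < min (card W) (card (V - W))"
          using W n by (auto simp: card_gt_0_iff finite_subset)
        then have "D \<le> \<phi> * real (min (card W) (card (V - W)))"
          using sp by (simp add: sparsity_def D_def divide_le_eq del: of_nat_min)
        moreover have "0 \<le> \<phi>"
          using sp by (rule order_trans[rotated]) (simp add: sparsity_def)
        ultimately show ?thesis
          unfolding w_def by (elim order_trans) (auto intro: mult_left_mono)
      qed
      then have "2 * (real n / real k) * D \<le> 2 * (real n / real k) * (\<phi> * w)"
        using nn by (intro mult_left_mono) auto
      also have "\<dots> = 2 * (real n / real k) * \<phi> * w"
        by simp
      also have "\<dots> \<le> \<epsilon> * w"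
        using step eps2 nn by (intro mult_right_mono) auto
      finally show ?thesis
        using disc by simp
    next
      assume sp: "terminal_sparsity V E T W \<le> ereal (real n / real k * (\<phi> / 10))"
      define d where "d = min (card (W \<inter> T)) (card ((V - W) \<inter> T))"
      \<comment> \<open>A zero \<open>d\<close> would make the terminal sparsity infinite,
        contradicting the finite bound \<open>sp\<close>.\<close>
      have d: "0 < d" "D / real d \<le> real n / real k * (\<phi> / 10)"
        using sp by (auto simp: terminal_sparsity_def d_def[symmetric] D_def Let_def split: if_splits)
      have "0 \<le> D / real d"
        by (simp add: D_def)
      then have pos: "0 \<le> real n / real k * (\<phi> / 10)"
        using d by linarith
      have "D \<le> real n / real k * (\<phi> / 10) * real d"
        using d by (simp add: divide_le_eq)
      also have "\<dots> \<le> real n / real k * (\<phi> / 10) * real (card (W \<inter> T))"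
        using pos by (intro mult_left_mono) (auto simp: d_def)
      also have "\<dots> = \<phi> / 10 * x"
        by (simp add: x_def mult_ac)
      finally have "2 * (real n / real k) * D \<le> 2 * (real n / real k) * (\<phi> / 10 * x)"
        using nn by (intro mult_left_mono) auto
      also have "\<dots> = 2 * (real n / real k) * \<phi> * (x / 10)"
        by (simp add: mult_ac)
      also have "\<dots> \<le> \<epsilon> * (x / 10)"
        using step eps2 nn by (intro mult_right_mono) auto
      \<comment> \<open>The error is now bounded by the estimate \<open>x\<close> rather than by the
        true size \<open>w\<close>. Since \<open>\<epsilon> < 1\<close>, the error is at most
        \<open>x / 10\<close>, so \<open>w\<close> is at least \<open>9 * x / 10\<close>; hence
        \<open>x / 10\<close> can be replaced by \<open>w\<close>.\<close>
      finally have *: "\<bar>x - w\<bar> \<le> \<epsilon> * (x / 10)"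
        using disc by simp
      also have "\<dots> \<le> x / 10"
        using eps nn by (simp add: mult_left_le_one_le)
      finally have "x / 10 \<le> w"
        using nn by linarith
      then have "\<epsilon> * (x / 10) \<le> \<epsilon> * w"
        using eps by simp
      with * show ?thesis
        by simp
    qed
    then show ?thesis
      by (simp add: x_def w_def)
  qed
  have "T \<noteq> {}"
    using T k by auto
  have "edge_sample_set V E \<epsilon> \<phi> T"
    unfolding edge_sample_set_def n_def[symmetric] T(1)
  proof (intro conjI allI impI)
    fix W
    assume "component_after_cut V E W \<or> all_but_one_component_after_cut V E W"
    then have "W \<subseteq> V"
      using component_after_cut_subset all_but_one_component_after_cut_subset by blast
    moreover assume "sparsity V E W \<le> \<phi> \<or> terminal_sparsity V E T W \<le> ereal (real n / real k * (\<phi> / 10))"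
    ultimately show "\<bar>real n / real k * real (card (W \<inter> T)) - real (card W)\<bar> \<le> \<epsilon> * real (card W)"
      by (rule accurate)
  qed (fact \<open>T \<noteq> {}\<close> T(2))+
  then show ?thesis
    by (simp only: T_def)
qed

text \<open>With \<open>x = n * \<phi> / \<epsilon>\<^sup>2\<close>, the hypotheses on
  \<open>k\<close> express that it is \<open>2 * x\<close> rounded up and cut off at
  \<open>n\<close>, in the form of the comparisons that the program makes. For
  \<open>k \<ge> 2\<close>, \<open>k \<le> 2 * (k - 1) < 4 * x\<close>; this gives the constants 2
  and 4.\<close>

lemma min_theta_size_ceiling:
  fixes \<epsilon> \<phi> :: real
  assumes "0 < \<epsilon>" "k \<le> n"
    and "k < n \<Longrightarrow> 2 * real n * \<phi> \<le> real k * \<epsilon>\<^sup>2"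
    and "k = 1 \<or> real (k - 1) * \<epsilon>\<^sup>2 < 2 * real n * \<phi>"
  shows "min_theta_size 2 4 (real n * (\<phi> / \<epsilon>\<^sup>2)) n k"
proof -
  define x where "x = real n * (\<phi> / \<epsilon>\<^sup>2)"
  have x: "k < n \<Longrightarrow> 2 * x \<le> real k" "k = 1 \<or> real (k - 1) < 2 * x"
    using assms by (auto simp: x_def field_simps)
  have "min (2 * x) (real n) \<le> real k"
    using x(1) assms(2) by (cases "k < n") auto
  moreover have "real k \<le> max 1 (4 * x)"
    using x(2) by (cases "k \<le> 1") (auto simp: of_nat_diff)
  ultimately show ?thesis
    using assms(2) by (simp add: min_theta_size_def x_def)
qed

section \<open>Depth-first search\<close>

text \<open>A state of the search: the vertices in order of discovery, and the stack with the
  current vertex on top. The choice of \<open>u\<close> is left open, so every order of the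
  adjacency lists is covered. An empty stack marks the end.\<close>

inductive dfs :: "'a set set \<Rightarrow> 'a \<Rightarrow> 'a list \<Rightarrow> 'a list \<Rightarrow> bool" for E r where
  start: "dfs E r [r] [r]"
| advance: "dfs E r xs (c # stk) \<Longrightarrow> {c, u} \<in> E \<Longrightarrow> u \<notin> set xs \<Longrightarrow> dfs E r (xs @ [u]) (u # c # stk)"
| retreat: "dfs E r xs (c # stk) \<Longrightarrow> \<forall>u. {c, u} \<in> E \<longrightarrow> u \<in> set xs \<Longrightarrow> dfs E r xs stk"

text \<open>Applied to the stack, these are the tree edges between the root and the current
  vertex.\<close>

fun path_edges :: "'a list \<Rightarrow> 'a set set" where
  "path_edges (x # y # zs) = insert {x, y} (path_edges (y # zs))"
| "path_edges _ = {}"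

lemma path_edges_subset: "e \<in> path_edges xs \<Longrightarrow> e \<subseteq> set xs"
  by (induction xs rule: path_edges.induct) auto

lemma finite_path_edges [simp]: "finite (path_edges xs)"
  by (induction xs rule: path_edges.induct) auto

lemma dfs_lists:
  assumes "dfs E r xs stk"
  shows "distinct xs \<and> distinct stk \<and> set stk \<subseteq> set xs \<and> r \<in> set xs"
  using assms by (induction rule: dfs.induct) auto

lemma dfs_vertices:
  assumes "dfs E r xs stk" "r \<in> V" "\<And>e. e \<in> E \<Longrightarrow> e \<subseteq> V"
  shows "set xs \<subseteq> V"
  using assms by (induction rule: dfs.induct) auto

text \<open>A vertex leaves the stack only when all its neighbours are listed, and the list only
  grows.\<close>

lemma dfs_neighbours:
  assumes "dfs E r xs stk" "v \<in> set xs - set stk" "{v, u} \<in> E"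
  shows "u \<in> set xs"
  using assms by (induction rule: dfs.induct) auto

lemma card_boundary_insert:
  assumes "finite A" "x \<noteq> y" "{x, y} \<notin> A"
  shows "card (boundary (insert {x, y} A) W) = card (boundary A W) + of_bool ((x \<in> W) \<noteq> (y \<in> W))"
proof -
  have "card ({x, y} \<inter> W) = 1 \<longleftrightarrow> (x \<in> W) \<noteq> (y \<in> W)"
    using assms(2) by (auto simp: Int_insert_left)
  then have "boundary (insert {x, y} A) W =
      (if (x \<in> W) \<noteq> (y \<in> W) then insert {x, y} (boundary A W) else boundary A W)"
    by (auto simp: boundary_def)
  moreover have "finite (boundary A W)" "{x, y} \<notin> boundary A W"
    using assms by (auto simp: boundary_def)
  ultimately show ?thesis
    by simp
qed

text \<open>The search walks along every tree edge twice: the edges on the stack have been crossed once,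
  those in \<open>B\<close> twice.\<close>

lemma dfs_potential:
  assumes "dfs E r xs stk" "finite E" "\<And>e. e \<in> E \<Longrightarrow> card e = 2"
  shows "\<exists>B. B \<subseteq> E \<and> path_edges stk \<subseteq> E \<and> B \<inter> path_edges stk = {} \<and> (\<forall>e\<in>B. e \<subseteq> set xs) \<and>
    card (B \<union> path_edges stk) + 1 = length xs \<and>
    (\<forall>W. changes W xs + (if stk = [] then 0 else of_bool ((last xs \<in> W) \<noteq> (hd stk \<in> W)))
      \<le> card (boundary (path_edges stk) W) + 2 * card (boundary B W))"
  using assms(1)
proof (induction rule: dfs.induct)
  case start
  show ?case
    by (rule exI[of _ "{}"]) simp
next
  case (advance xs c stk u)
  then obtain B where B: "B \<subseteq> E" "path_edges (c # stk) \<subseteq> E" "B \<inter> path_edges (c # stk) = {}"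
    "\<forall>e\<in>B. e \<subseteq> set xs" "card (B \<union> path_edges (c # stk)) + 1 = length xs"
    and pot: "\<And>W. changes W xs + of_bool ((last xs \<in> W) \<noteq> (c \<in> W))
      \<le> card (boundary (path_edges (c # stk)) W) + 2 * card (boundary B W)"
    by auto
  have sub: "set (c # stk) \<subseteq> set xs"
    using dfs_lists[OF advance.hyps(1)] by blast
  then have "xs \<noteq> []"
    by auto
  have "{c, u} \<notin> B" "{c, u} \<notin> path_edges (c # stk)" "u \<noteq> c"
    using B(4) path_edges_subset[of "{c, u}" "c # stk"] sub advance.hyps(3) by auto
  then have new: "{u, c} \<notin> B" "{u, c} \<notin> path_edges (c # stk)" "u \<noteq> c"
    by (simp_all add: insert_commute)
  have fin: "finite B"
    using B(1) assms(2) finite_subset by blast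
  \<comment> \<open>After an advance, the last listed vertex is the top of the stack, so the
    correction term vanishes. A change from \<open>last xs\<close> to \<open>u\<close> is paid for
    by the old correction term or by the new stack edge between \<open>c\<close> and
    \<open>u\<close>.\<close>
  have "changes W (xs @ [u]) + of_bool ((last (xs @ [u]) \<in> W) \<noteq> (hd (u # c # stk) \<in> W))
      \<le> card (boundary (path_edges (u # c # stk)) W) + 2 * card (boundary B W)" for W
  proof -
    have "of_bool ((last xs \<in> W) \<noteq> (u \<in> W)) \<le>
        of_bool ((last xs \<in> W) \<noteq> (c \<in> W)) + (of_bool ((u \<in> W) \<noteq> (c \<in> W)) :: nat)"
      by auto
    then show ?thesis
      using pot[of W] new by (simp add: changes_snoc \<open>xs \<noteq> []\<close> card_boundary_insert)
  qed
  \<comment> \<open>The count of tree edges is carried along because it yields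
    \<open>card V \<le> card E + 1\<close>, which bounds the running time in terms of edges.\<close>
  moreover have "card (B \<union> path_edges (u # c # stk)) + 1 = length (xs @ [u])"
    using B(5) new fin by simp
  ultimately show ?case
    using B(1-4) new advance.hyps(2) by (intro exI[of _ B]) (auto simp: insert_commute)
next
  case (retreat xs c stk)
  then obtain B where B: "B \<subseteq> E" "path_edges (c # stk) \<subseteq> E" "B \<inter> path_edges (c # stk) = {}"
    "\<forall>e\<in>B. e \<subseteq> set xs" "card (B \<union> path_edges (c # stk)) + 1 = length xs"
    and pot: "\<And>W. changes W xs + of_bool ((last xs \<in> W) \<noteq> (c \<in> W))
      \<le> card (boundary (path_edges (c # stk)) W) + 2 * card (boundary B W)"
    by auto
  show ?case
  proof (cases stk)
    case Nil
    have "changes W xs \<le> 2 * card (boundary B W)" for W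
      using pot[of W] by (simp add: Nil)
    then show ?thesis
      using B by (intro exI[of _ B]) (simp add: Nil)
  next
    case (Cons p ps)
    have lists: "distinct (c # stk)" "set (c # stk) \<subseteq> set xs"
      using dfs_lists[OF retreat.hyps(1)] by auto
    then have new: "{c, p} \<notin> path_edges stk" "c \<noteq> p"
      using path_edges_subset[of "{c, p}" stk] by (auto simp: Cons)
    have notB: "{c, p} \<notin> B"
      using B(3) by (auto simp: Cons)
    have fin: "finite B"
      using B(1) assms(2) finite_subset by blast
    \<comment> \<open>The edge \<open>{c, p}\<close> moves from the stack to \<open>B\<close>, so
      its weight rises from 1 to 2. The gain pays for measuring the correction term at
      \<open>p\<close> instead of \<open>c\<close>.\<close>
    have "changes W xs + of_bool ((last xs \<in> W) \<noteq> (p \<in> W))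
        \<le> card (boundary (path_edges stk) W) + 2 * card (boundary (insert {c, p} B) W)" for W
    proof -
      have "of_bool ((last xs \<in> W) \<noteq> (p \<in> W)) \<le>
          of_bool ((last xs \<in> W) \<noteq> (c \<in> W)) + (of_bool ((c \<in> W) \<noteq> (p \<in> W)) :: nat)"
        by auto
      then show ?thesis
        using pot[of W] new notB fin by (simp add: Cons card_boundary_insert)
    qed
    then show ?thesis
      using B lists new by (intro exI[of _ "insert {c, p} B"]) (auto simp: Cons)
  qed
qed

text \<open>With an empty stack, the listed vertices contain \<open>r\<close> and are closed under
  adjacency, so connectedness makes them all of \<open>V\<close>. In \<open>dfs_potential\<close>
  only the edges of \<open>B\<close> remain, each with weight 2.\<close>

lemma dfs_complete:
  assumes "connected_graph V E" "r \<in> V" "dfs E r xs []"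
  shows "distinct xs" "set xs = V" "changes W xs \<le> 2 * card (boundary E W)" "card V \<le> card E + 1"
proof -
  have fin: "finite V" "finite E" and two: "\<And>e. e \<in> E \<Longrightarrow> e \<subseteq> V" "\<And>e. e \<in> E \<Longrightarrow> card e = 2"
    using assms(1) finite_subset[of E "Pow V"] by (auto simp: connected_graph_def)
  show dist: "distinct xs"
    using dfs_lists[OF assms(3)] by blast
  have "v \<in> set xs" if "(r, v) \<in> (adj_rel E)\<^sup>*" for v
    using that
  proof (induction rule: rtrancl_induct)
    case base
    show ?case
      using dfs_lists[OF assms(3)] by blast
  next
    case (step y z)
    then show ?case
      using dfs_neighbours[OF assms(3)] by (auto simp: adj_rel_def)
  qed
  then show V: "set xs = V"
    using dfs_vertices[OF assms(3,2) two(1)] assms(1,2) by (auto simp: connected_graph_def)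
  obtain B where B: "B \<subseteq> E" "card B + 1 = length xs"
    "\<And>W. changes W xs \<le> 2 * card (boundary B W)"
    using dfs_potential[OF assms(3) fin(2) two(2)] by auto
  have "card (boundary B W) \<le> card (boundary E W)"
    using B(1) fin(2) by (intro card_mono) (auto simp: boundary_def)
  with B(3)[of W] show "changes W xs \<le> 2 * card (boundary E W)"
    by linarith
  show "card V \<le> card E + 1"
    using B(2) card_mono[OF fin(2) B(1)] dist V distinct_card by fastforce
qed

text \<open>In the measure an unlisted vertex counts twice: an advance gains 2 there and loses 1 to
  the longer stack, while a retreat shortens the stack.\<close>

lemma dfs_terminates:
  assumes "connected_graph V E" "r \<in> V" "dfs E r xs stk"
  shows "\<exists>ys. dfs E r ys []"
  using assms(3)
proof (induction "2 * (card V - length xs) + length stk" arbitrary: xs stk rule: less_induct)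
  case less
  show ?case
  proof (cases stk)
    case Nil
    then show ?thesis
      using less.prems by blast
  next
    case (Cons c ps)
    show ?thesis
    proof (cases "\<forall>u. {c, u} \<in> E \<longrightarrow> u \<in> set xs")
      case True
      then have "dfs E r xs ps"
        using less.prems Cons dfs.retreat by fastforce
      then show ?thesis
        using less.hyps[of xs ps] Cons by simp
    next
      case False
      then obtain u where "dfs E r (xs @ [u]) (u # stk)"
        using less.prems Cons dfs.advance by fastforce
      moreover from this have "length (xs @ [u]) \<le> card V"
        using dfs_vertices[OF _ assms(2)] dfs_lists assms(1) card_mono distinct_card
        unfolding connected_graph_def by metis
      ultimately show ?thesis
        using less.hyps[of "xs @ [u]" "u # stk"] by simp
    qed
  qed
qed

lemma ex_edge_sample_set:
  fixes \<epsilon> \<phi> :: real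
  assumes "connected_graph V E" "0 < \<epsilon>" "\<epsilon> < 1" "0 < \<phi>"
  shows "\<exists>T. edge_sample_set V E \<epsilon> \<phi> T \<and>
    min_theta_size 2 4 (real (card V) * (\<phi> / \<epsilon>\<^sup>2)) (card V) (card T)"
proof -
  obtain r where r: "r \<in> V"
    using assms(1) by (auto simp: connected_graph_def)
  obtain xs where xs: "dfs E r xs []"
    using dfs_terminates[OF assms(1) r dfs.start] by blast
  have n: "0 < card V"
    using assms(1) by (auto simp: connected_graph_def card_gt_0_iff)
  \<comment> \<open>The least real value of \<open>k\<close> satisfying the hypothesis of
    \<open>edge_sample_set_picked\<close>.\<close>
  define y where "y = 2 * real (card V) * \<phi> / \<epsilon>\<^sup>2"
  define k where "k = min (card V) (nat \<lceil>y\<rceil>)"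
  have y: "0 < y" "y * \<epsilon>\<^sup>2 = 2 * real (card V) * \<phi>"
    using n assms by (auto simp: y_def)
  have k: "0 < k" "k \<le> card V" "k < card V \<Longrightarrow> y \<le> real k" "k = 1 \<or> real (k - 1) < y"
    using n y(1) by (auto simp: k_def min_def) linarith+
  have k': "k < card V \<Longrightarrow> 2 * real (card V) * \<phi> \<le> real k * \<epsilon>\<^sup>2"
    "k = 1 \<or> real (k - 1) * \<epsilon>\<^sup>2 < 2 * real (card V) * \<phi>"
    using k(3,4) assms(2) by (auto simp flip: y(2))
  note complete = dfs_complete[OF assms(1) r xs]
  have "length xs = card V"
    using complete(1,2) distinct_card by fastforce
  then have "card (picked k (card V) xs) = k"
    using complete(1) k n by (intro card_picked) auto
  then show ?thesis
    using edge_sample_set_picked[OF assms(1) complete(1-3) assms(2,3) k(1,2) k'(1)]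
      min_theta_size_ceiling[OF assms(2) k(2) k'] by auto
qed

section \<open>Costs of programs\<close>

fun loop_free :: "prog \<Rightarrow> bool" where
  "loop_free (Seq c1 c2) \<longleftrightarrow> loop_free c1 \<and> loop_free c2"
| "loop_free (Cond b c1 c2) \<longleftrightarrow> loop_free c1 \<and> loop_free c2"
| "loop_free (Loop b c) \<longleftrightarrow> False"
| "loop_free _ \<longleftrightarrow> True"

text \<open>Loop-free programs always terminate, so their effect is a function that the simplifier
  can evaluate. The value at \<open>Loop\<close> is a dummy.\<close>

fun run :: "params \<Rightarrow> prog \<Rightarrow> store \<Rightarrow> store" where
  "run p Skip s = s"
| "run p (Write x i a) s = s(x := (s x)(nval s i := nval s a))"
| "run p (Seq c1 c2) s = run p c2 (run p c1 s)"
| "run p (Cond b c1 c2) s = (if bval p s b then run p c1 s else run p c2 s)"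
| "run p (Loop b c) s = s"

section \<open>Cost and growth bounds for expressions and loop-free programs\<close>

definition store_le :: "store \<Rightarrow> nat \<Rightarrow> bool" where
  "store_le s M \<longleftrightarrow> (\<forall>x i. s x i \<le> M)"

lemma store_le_mono: "store_le s M \<Longrightarrow> M \<le> N \<Longrightarrow> store_le s N"
  unfolding store_le_def using order_trans by blast

text \<open>A constant factor in the bound on the store therefore costs only an additive constant in
  the length of numbers.\<close>

lemma floorlog_mult_le: "floorlog 2 (a * b) \<le> floorlog 2 a + floorlog 2 b"
proof (cases "a = 0 \<or> b = 0")
  case True
  then show ?thesis
    by (auto simp: floorlog_def)
next
  case False
  then have "a * b < 2 ^ (floorlog 2 a + floorlog 2 b)"
    using floorlog_bounds[of a 2] floorlog_bounds[of b 2]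
    by (simp add: power_add mult_strict_mono)
  then show ?thesis
    by (intro floorlog_leI) auto
qed

lemma cost_add:
  fixes f g :: "store \<Rightarrow> nat"
  assumes "\<exists>K. \<forall>s M. store_le s M \<longrightarrow> 0 < M \<longrightarrow> f s \<le> K * (1 + floorlog 2 M)"
    and "\<exists>K. \<forall>s M. store_le s M \<longrightarrow> 0 < M \<longrightarrow> g s \<le> K * (1 + floorlog 2 M)"
  shows "\<exists>K. \<forall>s M. store_le s M \<longrightarrow> 0 < M \<longrightarrow> 1 + f s + g s \<le> K * (1 + floorlog 2 M)"
proof -
  obtain A B where
    A: "\<And>s M. store_le s M \<Longrightarrow> 0 < M \<Longrightarrow> f s \<le> A * (1 + floorlog 2 M)" and
    B: "\<And>s M. store_le s M \<Longrightarrow> 0 < M \<Longrightarrow> g s \<le> B * (1 + floorlog 2 M)"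
    using assms by blast
  have "1 + f s + g s \<le> (1 + A + B) * (1 + floorlog 2 M)" if "store_le s M" "0 < M" for s M
    using A[OF that] B[OF that] by (simp add: add_mult_distrib)
  then show ?thesis
    by blast
qed

lemma cost_Suc:
  fixes f :: "store \<Rightarrow> nat"
  assumes "\<exists>K. \<forall>s M. store_le s M \<longrightarrow> 0 < M \<longrightarrow> f s \<le> K * (1 + floorlog 2 M)"
  shows "\<exists>K. \<forall>s M. store_le s M \<longrightarrow> 0 < M \<longrightarrow> 1 + f s \<le> K * (1 + floorlog 2 M)"
  using cost_add[OF assms, of "\<lambda>_. 0"] by auto

text \<open>Addition and truncated subtraction are handled together, since both results are at most
  the sum of the operands.\<close>

lemma ncost_le_binary:
  fixes f :: "store \<Rightarrow> nat"
  assumes a: "\<exists>K. \<forall>s M. store_le s M \<longrightarrow> 0 < M \<longrightarrow> nval s a \<le> K * M \<and> ncost s a \<le> K * (1 + floorlog 2 M)"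
    and b: "\<exists>K. \<forall>s M. store_le s M \<longrightarrow> 0 < M \<longrightarrow> nval s b \<le> K * M \<and> ncost s b \<le> K * (1 + floorlog 2 M)"
    and f: "\<And>s. f s \<le> nval s a + nval s b"
  shows "\<exists>K. \<forall>s M. store_le s M \<longrightarrow> 0 < M \<longrightarrow>
    f s \<le> K * M \<and> 1 + ncost s a + ncost s b + floorlog 2 (f s) \<le> K * (1 + floorlog 2 M)"
proof -
  obtain A where A: "\<And>s M. store_le s M \<Longrightarrow> 0 < M \<Longrightarrow> nval s a \<le> A * M \<and> ncost s a \<le> A * (1 + floorlog 2 M)"
    using a by blast
  obtain B where B: "\<And>s M. store_le s M \<Longrightarrow> 0 < M \<Longrightarrow> nval s b \<le> B * M \<and> ncost s b \<le> B * (1 + floorlog 2 M)"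
    using b by blast
  define K where "K = 1 + A + B + floorlog 2 (A + B)"
  have "f s \<le> K * M \<and> 1 + ncost s a + ncost s b + floorlog 2 (f s) \<le> K * (1 + floorlog 2 M)"
    if "store_le s M" "0 < M" for s M
  proof -
    have fs: "f s \<le> (A + B) * M"
      using f[of s] A[OF that] B[OF that] by (simp add: add_mult_distrib)
    then have "floorlog 2 (f s) \<le> floorlog 2 (A + B) + floorlog 2 M"
      using floorlog_mono floorlog_mult_le order_trans by blast
    then have "1 + ncost s a + ncost s b + floorlog 2 (f s) \<le> K * (1 + floorlog 2 M)"
      using A[OF that] B[OF that] by (simp add: K_def add_mult_distrib)
    moreover have "(A + B) * M \<le> K * M"
      by (intro mult_right_mono) (auto simp: K_def)
    ultimately show ?thesis
      using fs by linarith
  qed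
  then show ?thesis
    by blast
qed

text \<open>Values and costs are bounded simultaneously, because an operation is charged the length
  of its result. The constant depends on the expression alone.\<close>

lemma ncost_le:
  "\<exists>K. \<forall>s M. store_le s M \<longrightarrow> 0 < M \<longrightarrow> nval s e \<le> K * M \<and> ncost s e \<le> K * (1 + floorlog 2 M)"
proof (induction e)
  case (NConst k)
  have "k \<le> (1 + k + floorlog 2 k) * M" "1 + floorlog 2 k \<le> (1 + k + floorlog 2 k) * (1 + floorlog 2 M)"
    if "0 < M" for M
    using that by (cases M) auto
  then show ?case
    by (intro exI[of _ "1 + k + floorlog 2 k"]) auto
next
  case (NRead x e)
  then obtain K where K: "\<And>s M. store_le s M \<Longrightarrow> 0 < M \<Longrightarrow> ncost s e \<le> K * (1 + floorlog 2 M)"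
    by blast
  have "s x (nval s e) \<le> (1 + K) * M \<and>
      1 + ncost s e + floorlog 2 (s x (nval s e)) \<le> (1 + K) * (1 + floorlog 2 M)"
    if "store_le s M" "0 < M" for s M
  proof -
    have "s x (nval s e) \<le> M"
      using that by (simp add: store_le_def)
    moreover from this have "floorlog 2 (s x (nval s e)) \<le> floorlog 2 M"
      by (rule floorlog_mono)
    ultimately show ?thesis
      using K[OF that] by simp
  qed
  then show ?case
    by (intro exI[of _ "1 + K"]) simp
next
  case (NAdd a b)
  then show ?case
    using ncost_le_binary[of a b "\<lambda>s. nval s a + nval s b"] by simp
next
  case (NSub a b)
  then show ?case
    using ncost_le_binary[of a b "\<lambda>s. nval s a - nval s b"] by simp
qed

lemma ncost_le': "\<exists>K. \<forall>s M. store_le s M \<longrightarrow> 0 < M \<longrightarrow> ncost s e \<le> K * (1 + floorlog 2 M)"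
  using ncost_le by blast

lemma rcost_le: "\<exists>K. \<forall>s M. store_le s M \<longrightarrow> 0 < M \<longrightarrow> rcost s e \<le> K * (1 + floorlog 2 M)"
proof (induction e)
  case (RParam i)
  show ?case
    by (intro exI[of _ 1]) simp
next
  case (ROfNat a)
  show ?case
    using cost_Suc[OF ncost_le'] by simp
qed (use cost_add in simp_all)

lemma bcost_le: "\<exists>K. \<forall>s M. store_le s M \<longrightarrow> 0 < M \<longrightarrow> bcost s b \<le> K * (1 + floorlog 2 M)"
proof (induction b)
  case (NLess a b)
  show ?case
    using cost_add[OF ncost_le' ncost_le'] by simp
next
  case (RLess a b)
  show ?case
    using cost_add[OF rcost_le rcost_le] by simp
next
  case (BNot b)
  then show ?case
    using cost_Suc by simp
next
  case (BAnd a b)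
  then show ?case
    using cost_add by simp
qed

text \<open>A loop-free program enlarges the stored numbers by at most a constant factor, so a bound on the
  store at the loop heads suffices and the intermediate values need not be tracked.\<close>

lemma loop_free_exec:
  assumes "loop_free c"
  shows "\<exists>K. \<forall>p s M. store_le s M \<longrightarrow> 0 < M \<longrightarrow> store_le (run p c s) (K * M) \<and>
    (\<exists>t\<le>K * (1 + floorlog 2 M). exec p c s t (run p c s))"
  using assms
proof (induction c)
  case Skip
  show ?case
    using exec.Skip by (intro exI[of _ 1]) fastforce
next
  case (Write x i a)
  obtain A where A: "\<And>s M. store_le s M \<Longrightarrow> 0 < M \<Longrightarrow> nval s a \<le> A * M"
    using ncost_le[of a] by blast
  obtain K where K: "\<And>s M. store_le s M \<Longrightarrow> 0 < M \<Longrightarrow>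
      1 + ncost s i + ncost s a \<le> K * (1 + floorlog 2 M)"
    using cost_add[OF ncost_le'[of i] ncost_le'[of a]] by blast
  have "store_le (run p (Write x i a) s) ((1 + A + K) * M) \<and>
      (\<exists>t\<le>(1 + A + K) * (1 + floorlog 2 M). exec p (Write x i a) s t (run p (Write x i a) s))"
    if "store_le s M" "0 < M" for p s M
  proof
    show "store_le (run p (Write x i a) s) ((1 + A + K) * M)"
      using that(1) A[OF that] by (auto simp: store_le_def add_mult_distrib intro: trans_le_add1)
    have "K * (1 + floorlog 2 M) \<le> (1 + A + K) * (1 + floorlog 2 M)"
      by (intro mult_right_mono) auto
    then show "\<exists>t\<le>(1 + A + K) * (1 + floorlog 2 M). exec p (Write x i a) s t (run p (Write x i a) s)"
      using K[OF that] exec.Write[of p x i a s] order_trans by (metis run.simps(2))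
  qed
  then show ?case
    by blast
next
  case (Seq c1 c2)
  obtain A where A: "\<And>p s M. store_le s M \<Longrightarrow> 0 < M \<Longrightarrow> store_le (run p c1 s) (A * M) \<and>
    (\<exists>t\<le>A * (1 + floorlog 2 M). exec p c1 s t (run p c1 s))"
    using Seq by auto
  obtain B where B: "\<And>p s M. store_le s M \<Longrightarrow> 0 < M \<Longrightarrow> store_le (run p c2 s) (B * M) \<and>
    (\<exists>t\<le>B * (1 + floorlog 2 M). exec p c2 s t (run p c2 s))"
    using Seq by auto
  \<comment> \<open>The successor keeps \<open>A' * M\<close> positive, as the induction hypothesis
    for \<open>c2\<close> requires.\<close>
  define A' where "A' = Suc A"
  define K where "K = B * A' + A + B * (1 + floorlog 2 A')"
  have "store_le (run p (Seq c1 c2) s) (K * M) \<and>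
      (\<exists>t\<le>K * (1 + floorlog 2 M). exec p (Seq c1 c2) s t (run p (Seq c1 c2) s))"
    if s: "store_le s M" "0 < M" for p s M
  proof
    have M': "store_le (run p c1 s) (A' * M)" "0 < A' * M"
      using A[OF s, of p] s(2) by (auto simp: store_le_def A'_def intro: trans_le_add2)
    have "B * A' * M \<le> K * M"
      by (intro mult_right_mono) (auto simp: K_def)
    then have "B * (A' * M) \<le> K * M"
      by (simp add: mult.assoc)
    then show "store_le (run p (Seq c1 c2) s) (K * M)"
      using B[OF M', of p] by (auto intro: store_le_mono simp del: mult_le_cancel2)
    obtain t1 where t1: "t1 \<le> A * (1 + floorlog 2 M)" "exec p c1 s t1 (run p c1 s)"
      using A[OF s] by blast
    obtain t2 where t2: "t2 \<le> B * (1 + floorlog 2 (A' * M))" "exec p c2 (run p c1 s) t2 (run p c2 (run p c1 s))"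
      using B[OF M'] by blast
    have "B * (1 + floorlog 2 (A' * M)) \<le> B * (1 + floorlog 2 A' + floorlog 2 M)"
      using floorlog_mult_le[of A' M] by (intro mult_left_mono) auto
    also have "\<dots> \<le> B * ((1 + floorlog 2 A') * (1 + floorlog 2 M))"
      by (intro mult_left_mono) (auto simp: algebra_simps)
    finally have "t1 + t2 \<le> K * (1 + floorlog 2 M)"
      using t1(1) t2(1) by (simp add: K_def algebra_simps)
    then show "\<exists>t\<le>K * (1 + floorlog 2 M). exec p (Seq c1 c2) s t (run p (Seq c1 c2) s)"
      using exec.Seq[OF t1(2) t2(2)] by auto
  qed
  then show ?case
    by blast
next
  case (Cond b c1 c2)
  obtain A where A: "\<And>p s M. store_le s M \<Longrightarrow> 0 < M \<Longrightarrow> store_le (run p c1 s) (A * M) \<and>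
    (\<exists>t\<le>A * (1 + floorlog 2 M). exec p c1 s t (run p c1 s))"
    using Cond by auto
  obtain B where B: "\<And>p s M. store_le s M \<Longrightarrow> 0 < M \<Longrightarrow> store_le (run p c2 s) (B * M) \<and>
    (\<exists>t\<le>B * (1 + floorlog 2 M). exec p c2 s t (run p c2 s))"
    using Cond by auto
  obtain D where D: "\<And>s M. store_le s M \<Longrightarrow> 0 < M \<Longrightarrow> bcost s b \<le> D * (1 + floorlog 2 M)"
    using bcost_le by blast
  define K where "K = 1 + D + A + B"
  have "store_le (run p (Cond b c1 c2) s) (K * M) \<and>
      (\<exists>t\<le>K * (1 + floorlog 2 M). exec p (Cond b c1 c2) s t (run p (Cond b c1 c2) s))"
    if s: "store_le s M" "0 < M" for p s M
  proof
    have "A * M \<le> K * M" "B * M \<le> K * M"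
      by (intro mult_right_mono; simp add: K_def)+
    then show "store_le (run p (Cond b c1 c2) s) (K * M)"
      using A[OF s, of p] B[OF s, of p] by (auto intro: store_le_mono simp del: mult_le_cancel2)
    have *: "1 + bcost s b + t \<le> K * (1 + floorlog 2 M)"
      if "t \<le> A * (1 + floorlog 2 M) \<or> t \<le> B * (1 + floorlog 2 M)" for t
      using that D[OF s] by (auto simp: K_def add_mult_distrib)
    show "\<exists>t\<le>K * (1 + floorlog 2 M). exec p (Cond b c1 c2) s t (run p (Cond b c1 c2) s)"
    proof (cases "bval p s b")
      case True
      then show ?thesis
        using A[OF s, of p] * exec.CondTrue[OF True, of c1 _ _ c2] by fastforce
    next
      case False
      then show ?thesis
        using B[OF s, of p] * exec.CondFalse[OF False, of c2 _ _ c1] by fastforce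
    qed
  qed
  then show ?case
    by blast
qed simp

text \<open>The first argument of \<open>I\<close> is a variant, so there are at most
  \<open>m\<close> iterations. Each costs at most \<open>K\<close> for the guard, \<open>K\<close>
  for the body and 1 for the loop itself; the extra summand in \<open>m + 1\<close> covers the final
  test.\<close>

lemma exec_Loop_bounded:
  assumes "\<And>m s. I m s \<Longrightarrow> bcost s b \<le> K"
    and "\<And>m s. I m s \<Longrightarrow> bval p s b \<Longrightarrow> \<exists>t s' m'. exec p c s t s' \<and> t \<le> K \<and> I m' s' \<and> m' < (m::nat)"
    and "I m s"
  shows "\<exists>t s' m'. exec p (Loop b c) s t s' \<and> t \<le> (m + 1) * (2 * K + 1) \<and> I m' s' \<and> \<not> bval p s' b"
  using assms(3)
proof (induction m arbitrary: s rule: less_induct)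
  case (less m)
  show ?case
  proof (cases "bval p s b")
    case True
    obtain t1 s1 m1 where 1: "exec p c s t1 s1" "t1 \<le> K" "I m1 s1" "m1 < m"
      using assms(2)[OF less.prems True] by blast
    obtain t2 s2 m2 where 2: "exec p (Loop b c) s1 t2 s2" "t2 \<le> (m1 + 1) * (2 * K + 1)"
      "I m2 s2" "\<not> bval p s2 b"
      using less.IH[OF 1(4,3)] by blast
    have "(m1 + 1) * (2 * K + 1) \<le> m * (2 * K + 1)"
      using 1(4) by (intro mult_right_mono) auto
    then have "1 + bcost s b + t1 + t2 \<le> (m + 1) * (2 * K + 1)"
      using assms(1)[OF less.prems] 1(2) 2(2) by simp
    then show ?thesis
      using exec.LoopTrue[OF True 1(1) 2(1)] 2(3,4) by blast
  next
    case False
    have "1 + bcost s b \<le> (m + 1) * (2 * K + 1)"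
      using assms(1)[OF less.prems] by simp
    then show ?thesis
      using exec.LoopFalse[of p s b c] False less.prems by blast
  qed
qed

text \<open>The constant is chosen before parameters, invariant and store, so one value serves all
  inputs. The invariant must restore the same bound \<open>M\<close> at every loop head, which stops
  the constant-factor growth of the body from accumulating.\<close>

lemma loop_free_Loop:
  assumes "loop_free c"
  shows "\<exists>K. \<forall>p I m s M. 0 < M \<longrightarrow>
    (\<forall>m s. I m s \<longrightarrow> store_le s M \<and> (bval p s b \<longrightarrow> (\<exists>m'<(m::nat). I m' (run p c s)))) \<longrightarrow> I m s \<longrightarrow>
    (\<exists>t s' m'. exec p (Loop b c) s t s' \<and> t \<le> K * ((m + 1) * (1 + floorlog 2 M)) \<and> I m' s' \<and> \<not> bval p s' b)"
proof -
  obtain A where A: "\<And>p s M. store_le s M \<Longrightarrow> 0 < M \<Longrightarrow>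
    (\<exists>t\<le>A * (1 + floorlog 2 M). exec p c s t (run p c s))"
    using loop_free_exec[OF assms] by blast
  obtain D where D: "\<And>s M. store_le s M \<Longrightarrow> 0 < M \<Longrightarrow> bcost s b \<le> D * (1 + floorlog 2 M)"
    using bcost_le by blast
  have bound: "\<exists>t s' m'. exec p (Loop b c) s t s' \<and> t \<le> (2 * (A + D) + 1) * ((m + 1) * (1 + floorlog 2 M)) \<and>
      I m' s' \<and> \<not> bval p s' b"
    if M: "0 < M" and I: "\<And>m s. I m s \<Longrightarrow> store_le s M"
      "\<And>m s. I m s \<Longrightarrow> bval p s b \<Longrightarrow> \<exists>m'<m. I m' (run p c s)" "I m s"
    for p M s and I :: "nat \<Rightarrow> store \<Rightarrow> bool" and m :: nat
  proof -
    define L where "L = 1 + floorlog 2 M"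
    have cost: "A * L \<le> (A + D) * L" "D * L \<le> (A + D) * L"
      by simp_all
    obtain t s' m' where t: "exec p (Loop b c) s t s'" "t \<le> (m + 1) * (2 * ((A + D) * L) + 1)"
      "I m' s'" "\<not> bval p s' b"
    proof (atomize_elim, rule exec_Loop_bounded)
      show "bcost s b \<le> (A + D) * L" if "I m s" for m s
        using D[OF I(1)[OF that] M] cost(2) by (simp add: L_def)
      show "\<exists>t s' m'. exec p c s t s' \<and> t \<le> (A + D) * L \<and> I m' s' \<and> m' < m"
        if "I m s" "bval p s b" for m s
        using A[OF I(1)[OF that(1)] M, of p] I(2)[OF that] cost(1) unfolding L_def[symmetric]
        by (meson order_trans)
    qed (fact I(3))
    have "(m + 1) * (2 * ((A + D) * L) + 1) \<le> (2 * (A + D) + 1) * ((m + 1) * L)"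
      by (simp add: L_def algebra_simps)
    then show ?thesis
      using t unfolding L_def by (meson order_trans)
  qed
  show ?thesis
  proof (rule exI[of _ "2 * (A + D) + 1"], intro allI impI)
    fix p I m s M
    assume "0 < M" "\<forall>m s. I m s \<longrightarrow> store_le s M \<and> (bval p s b \<longrightarrow> (\<exists>m'<(m::nat). I m' (run p c s)))" "I m s"
    then show "\<exists>t s' m'. exec p (Loop b c) s t s' \<and> t \<le> (2 * (A + D) + 1) * ((m + 1) * (1 + floorlog 2 M)) \<and>
        I m' s' \<and> \<not> bval p s' b"
      by (intro bound[where I = I]) simp_all
  qed
qed

section \<open>The sampling program\<close>

abbreviation scalar :: "string \<Rightarrow> nexp" where
  "scalar x \<equiv> NRead x (NConst 0)"

text \<open>Real values cannot be stored or rounded, so \<open>k\<close> is found by counting up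
  while \<open>k * \<epsilon>\<^sup>2 < 2 * n * \<phi>\<close>. The first conjunct caps
  \<open>k\<close> at \<open>n\<close>.\<close>

definition "count_guard =
  BAnd (NLess (scalar ''k'') (scalar ''n''))
    (RLess (RMul (ROfNat (scalar ''k'')) (RMul (RParam 0) (RParam 0)))
      (RMul (ROfNat (NAdd (scalar ''n'') (scalar ''n''))) (RParam 1)))"

definition "count_body = Write ''k'' (NConst 0) (NAdd (scalar ''k'') (NConst 1))"

definition "visit =
  Seq (Write ''vis'' (scalar ''u'') (NConst 1))
  (Seq (Write ''stk'' (scalar ''sp'') (scalar ''u''))
  (Seq (Write ''sp'' (NConst 0) (NAdd (scalar ''sp'') (NConst 1)))
  (Seq (Write ''acc'' (NConst 0) (NAdd (scalar ''acc'') (scalar ''k'')))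
  (Cond (NLess (scalar ''acc'') (scalar ''n'')) Skip
    (Seq (Write ''acc'' (NConst 0) (NSub (scalar ''acc'') (scalar ''n'')))
    (Write ''out'' (scalar ''u'') (NConst 1)))))))"

text \<open>One step scans a single adjacency entry of the top vertex, or pops that vertex when its
  list is exhausted.\<close>

definition "step_body =
  Seq (Write ''c'' (NConst 0) (NRead ''stk'' (NSub (scalar ''sp'') (NConst 1))))
  (Cond (NLess (NAdd (NRead ''off'' (scalar ''c'')) (NRead ''pos'' (scalar ''c'')))
      (NRead ''off'' (NAdd (scalar ''c'') (NConst 1))))
    (Seq (Write ''u'' (NConst 0)
      (NRead ''adj'' (NAdd (NRead ''off'' (scalar ''c'')) (NRead ''pos'' (scalar ''c'')))))
    (Seq (Write ''pos'' (scalar ''c'') (NAdd (NRead ''pos'' (scalar ''c'')) (NConst 1)))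
    (Cond (NLess (NConst 0) (NRead ''vis'' (scalar ''u''))) Skip visit)))
    (Write ''sp'' (NConst 0) (NSub (scalar ''sp'') (NConst 1))))"

definition "sample_prog =
  Seq (Loop count_guard count_body)
  (Seq visit (Loop (NLess (NConst 0) (scalar ''sp'')) step_body))"

text \<open>Vertices are selected while they are visited: the counter \<open>acc\<close> grows by \<open>k\<close> modulo \<open>n\<close>, and the
  vertex is output whenever \<open>acc\<close> wraps around.  Memory that is initially zero makes vertex \<open>0\<close> the root
  and every \<open>pos v\<close>, the number of scanned neighbours of \<open>v\<close>, start at \<open>0\<close>.\<close>

definition represents :: "nat list list \<Rightarrow> nat \<Rightarrow> store \<Rightarrow> nat list \<Rightarrow> nat list \<Rightarrow> bool" where
  "represents ls k s xs stk \<longleftrightarrow>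
     s ''n'' 0 = length ls \<and>
     (\<forall>v\<le>length ls. s ''off'' v = length (concat (take v ls))) \<and>
     (\<forall>i<length (concat ls). s ''adj'' i = concat ls ! i) \<and>
     s ''k'' 0 = k \<and>
     s ''sp'' 0 = length stk \<and>
     (\<forall>i<length stk. s ''stk'' i = rev stk ! i) \<and>
     (\<forall>v. s ''vis'' v = of_bool (v \<in> set xs)) \<and>
     s ''acc'' 0 = length xs * k mod length ls \<and>
     (\<forall>v. s ''out'' v = of_bool (v \<in> picked k (length ls) xs))"

section \<open>Simulation of the abstract search by the program\<close>

lemma concat_nth_take:
  assumes "v < length ls" "j < length (ls ! v)"
  shows "concat ls ! (length (concat (take v ls)) + j) = ls ! v ! j"
    and "length (concat (take v ls)) + j < length (concat ls)"
proof -
  have "concat ls = concat (take v ls) @ ls ! v @ concat (drop (Suc v) ls)"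
    by (metis assms(1) append_take_drop_id concat.simps(2) concat_append Cons_nth_drop_Suc)
  then show "concat ls ! (length (concat (take v ls)) + j) = ls ! v ! j"
    and "length (concat (take v ls)) + j < length (concat ls)"
    using assms(2) by (simp_all add: nth_append)
qed

lemma length_concat_take_Suc:
  "v < length ls \<Longrightarrow> length (concat (take (Suc v) ls)) = length (concat (take v ls)) + length (ls ! v)"
  by (simp add: take_Suc_conv_app_nth)

text \<open>By \<open>div_step\<close>, \<open>acc\<close> wraps around exactly when the quotient in
  \<open>picked\<close> jumps, so \<open>out\<close> changes just as in \<open>picked_snoc\<close>.
  The bound \<open>M\<close> is kept exactly, ready for use in a loop invariant.\<close>

lemma run_visit:
  assumes rep: "represents ls k s xs stk" and le: "store_le s M"
    and u: "s ''u'' 0 = u" "u \<notin> set xs" and k: "k \<le> length ls" "0 < length ls"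
    and M: "length ls \<le> M" "length stk < length ls"
  shows "represents ls k (run p visit s) (xs @ [u]) (u # stk)"
    and "store_le (run p visit s) M"
    and "run p visit s ''pos'' = s ''pos''"
proof -
  define r where "r = length xs * k mod length ls"
  have r: "r < length ls"
    using k by (simp add: r_def)
  have div: "Suc (length xs) * k div length ls \<noteq> length xs * k div length ls \<longleftrightarrow> length ls \<le> r + k"
    "Suc (length xs) * k mod length ls = r + k - (if length ls \<le> r + k then length ls else 0)"
    using div_step[OF k, of "length xs * k"] by (simp_all add: r_def add.commute)
  have s: "s ''n'' 0 = length ls" "s ''k'' 0 = k" "s ''sp'' 0 = length stk" "s ''acc'' 0 = r"
    using rep by (simp_all add: represents_def r_def)
  have run: "run p visit s = s(''vis'' := (s ''vis'')(u := 1), ''stk'' := (s ''stk'')(length stk := u),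
      ''sp'' := (s ''sp'')(0 := Suc (length stk)),
      ''acc'' := (s ''acc'')(0 := r + k - (if length ls \<le> r + k then length ls else 0)),
      ''out'' := (if length ls \<le> r + k then (s ''out'')(u := 1) else s ''out''))"
    by (rule ext) (simp add: visit_def s u(1) fun_eq_iff)
  have out: "picked k (length ls) (xs @ [u]) = picked k (length ls) xs \<union> (if length ls \<le> r + k then {u} else {})"
    by (simp only: picked_snoc div(1))
  have stk: "rev (u # stk) ! i = (if i = length stk then u else rev stk ! i)" if "i < Suc (length stk)" for i
    using that by (simp add: nth_append)
  show "represents ls k (run p visit s) (xs @ [u]) (u # stk)"
    using rep unfolding represents_def run out by (auto simp: stk div(2) simp del: mult_Suc rev.simps)
  have "u \<le> M"
    using le u(1) by (auto simp: store_le_def)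
  moreover have "r + k - (if length ls \<le> r + k then length ls else 0) \<le> M"
    using r k(1) M(1) by auto
  ultimately show "store_le (run p visit s) M"
    using le M unfolding run store_le_def by auto
  show "run p visit s ''pos'' = s ''pos''"
    unfolding run by simp
qed

definition size_bound :: "nat list list \<Rightarrow> nat" where
  "size_bound ls = length (concat ls) + length ls + 1"

text \<open>The variant adds unscanned adjacency entries, unvisited vertices and stack height; every
  step lowers it by one. Scanned entries being listed is what justifies a retreat once a list is
  exhausted.\<close>

definition search_inv :: "nat set set \<Rightarrow> nat list list \<Rightarrow> nat \<Rightarrow> nat \<Rightarrow> store \<Rightarrow> bool" where
  "search_inv E ls k m s \<longleftrightarrow> (\<exists>xs stk. represents ls k s xs stk \<and> store_le s (size_bound ls) \<and>
     dfs E 0 xs stk \<and>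
     (\<forall>v<length ls. s ''pos'' v \<le> length (ls ! v) \<and> (\<forall>j<s ''pos'' v. ls ! v ! j \<in> set xs)) \<and>
     m = (\<Sum>v<length ls. length (ls ! v) - s ''pos'' v) + (length ls - length xs) + length stk)"

lemma search_inv_step:
  assumes graph: "connected_graph {..<length ls} E" "adjacency_lists (length ls) E ls"
    and k: "k \<le> length ls" "0 < length ls"
    and inv: "search_inv E ls k m s" and sp: "0 < s ''sp'' 0"
  shows "\<exists>m'<m. search_inv E ls k m' (run p step_body s)"
proof -
  define n where "n = length ls"
  obtain xs stk where rep: "represents ls k s xs stk" and le: "store_le s (size_bound ls)"
    and dfs: "dfs E 0 xs stk"
    and pos: "\<And>v. v < n \<Longrightarrow> s ''pos'' v \<le> length (ls ! v)"
      "\<And>v j. v < n \<Longrightarrow> j < s ''pos'' v \<Longrightarrow> ls ! v ! j \<in> set xs"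
    and m: "m = (\<Sum>v<n. length (ls ! v) - s ''pos'' v) + (n - length xs) + length stk"
    using inv unfolding search_inv_def n_def by blast
  have "s ''sp'' 0 = length stk"
    using rep by (simp add: represents_def)
  then obtain c rest where stk: "stk = c # rest"
    using sp by (cases stk) auto
  have edge: "e \<subseteq> {..<n}" if "e \<in> E" for e
    using graph(1) that by (simp add: connected_graph_def n_def)
  have xs: "distinct xs" "distinct stk" "set stk \<subseteq> set xs" "set xs \<subseteq> {..<n}"
    using dfs_lists[OF dfs] dfs_vertices[OF dfs, of "{..<n}"] edge k(2) by (auto simp: n_def)
  have c: "c < n"
    using xs by (auto simp: stk)
  have nbs: "set (ls ! c) = {u. {c, u} \<in> E}"
    using graph(2) c by (simp add: adjacency_lists_def n_def)
  have s: "s ''sp'' 0 = Suc (length rest)" "s ''stk'' (length rest) = c"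
    "s ''off'' c = length (concat (take c ls))"
    "s ''off'' (Suc c) = length (concat (take c ls)) + length (ls ! c)"
    using rep c length_concat_take_Suc[of c ls]
    by (auto simp: represents_def stk nth_append n_def)
  let ?s1 = "s(''c'' := (s ''c'')(0 := c))"
  have cM: "c \<le> size_bound ls"
    using c by (simp add: size_bound_def n_def)
  show ?thesis
  proof (cases "s ''pos'' c < length (ls ! c)")
    case True
    define u where "u = ls ! c ! s ''pos'' c"
    define s2 where "s2 = ?s1(''u'' := (s ''u'')(0 := u), ''pos'' := (s ''pos'')(c := Suc (s ''pos'' c)))"
    have adj: "s ''adj'' (length (concat (take c ls)) + s ''pos'' c) = u"
      using rep concat_nth_take[OF _ True] c by (simp add: represents_def u_def n_def)
    have cu: "{c, u} \<in> E"
      using nbs nth_mem[OF True] by (auto simp: u_def)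
    then have "u < n"
      using edge by blast
    have rep2: "represents ls k s2 xs stk"
      using rep by (simp add: represents_def s2_def)
    have "length (concat (take c ls)) + s ''pos'' c < length (concat ls)"
      using concat_nth_take(2)[OF _ True] c by (simp add: n_def)
    then have le2: "store_le s2 (size_bound ls)"
      using le cM \<open>u < n\<close> by (auto simp: store_le_def s2_def size_bound_def n_def)
    have run: "run p step_body s = (if 0 < s ''vis'' u then s2 else run p visit s2)"
      using True by (simp add: step_body_def s s2_def adj)
    have pos2: "s2 ''pos'' = (s ''pos'')(c := Suc (s ''pos'' c))"
      by (simp add: s2_def)
    \<comment> \<open>The entry just scanned is \<open>u\<close>, which is listed already or about
      to be appended; hence the union with \<open>{u}\<close>.\<close>
    have scanned: "s2 ''pos'' v \<le> length (ls ! v) \<and> (\<forall>j<s2 ''pos'' v. ls ! v ! j \<in> set xs \<union> {u})"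
      if "v < n" for v
      using pos[OF that] True by (auto simp: pos2 less_Suc_eq u_def)
    have sum: "(\<Sum>v<n. length (ls ! v) - s ''pos'' v) = Suc (\<Sum>v<n. length (ls ! v) - s2 ''pos'' v)"
    proof -
      have "(\<Sum>v\<in>{..<n} - {c}. length (ls ! v) - s ''pos'' v) = (\<Sum>v\<in>{..<n} - {c}. length (ls ! v) - s2 ''pos'' v)"
        by (rule sum.cong) (auto simp: pos2)
      then show ?thesis
        using True c by (simp add: sum.remove[of "{..<n}" c] pos2)
    qed
    show ?thesis
    proof (cases "u \<in> set xs")
      case in_xs: True
      then have "run p step_body s = s2"
        using run rep by (simp add: represents_def)
      moreover have "search_inv E ls k (m - 1) s2"
        unfolding search_inv_def
        using rep2 le2 dfs scanned in_xs m sum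
        by (intro exI[of _ xs] exI[of _ stk]) (auto simp: n_def insert_absorb)
      moreover have "m - 1 < m"
        using m sum by simp
      ultimately show ?thesis
        by auto
    next
      case False
      then have run': "run p step_body s = run p visit s2"
        using run rep by (simp add: represents_def)
      have dfs': "dfs E 0 (xs @ [u]) (u # stk)"
        using dfs.advance[OF dfs[unfolded stk] cu False] by (simp add: stk)
      have "card (insert u (set xs)) \<le> card {..<n}"
        using xs(4) \<open>u < n\<close> by (intro card_mono) auto
      then have len: "length xs < n"
        using xs(1) False by (simp add: distinct_card)
      \<comment> \<open>Stack entries are distinct listed vertices and \<open>u\<close> is unlisted,
        so there is room for the push within the store bound.\<close>
      moreover have "length stk \<le> length xs"
        using xs by (metis card_mono distinct_card List.finite_set)
      ultimately have "length stk < length ls"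
        by (simp add: n_def)
      then have visit: "represents ls k (run p visit s2) (xs @ [u]) (u # stk)"
        "store_le (run p visit s2) (size_bound ls)" "run p visit s2 ''pos'' = s2 ''pos''"
        using run_visit[OF rep2 le2 _ False k, of p] by (auto simp: s2_def size_bound_def)
      have "search_inv E ls k (m - 1) (run p visit s2)"
        unfolding search_inv_def
        using visit dfs' scanned m sum len
        by (intro exI[of _ "xs @ [u]"] exI[of _ "u # stk"]) (auto simp: n_def)
      moreover have "m - 1 < m"
        using m sum by simp
      ultimately show ?thesis
        unfolding run' by blast
    qed
  next
    case False
    then have "s ''pos'' c = length (ls ! c)"
      using pos(1)[OF c] by simp
    then have "set (ls ! c) \<subseteq> set xs"
      using pos(2)[OF c] by (auto simp: in_set_conv_nth)
    then have dfs': "dfs E 0 xs rest"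
      using dfs.retreat[OF dfs[unfolded stk]] nbs by auto
    define s2 where "s2 = ?s1(''sp'' := (s ''sp'')(0 := length rest))"
    have run: "run p step_body s = s2"
      using False by (simp add: step_body_def s s2_def)
    have "represents ls k s2 xs rest"
      using rep by (auto simp: represents_def s2_def stk nth_append)
    moreover have "length rest \<le> size_bound ls"
      using le s(1) Suc_leD unfolding store_le_def by metis
    then have "store_le s2 (size_bound ls)"
      using le cM by (auto simp: store_le_def s2_def)
    ultimately have "search_inv E ls k (m - 1) s2"
      unfolding search_inv_def
      using dfs' pos m stk
      by (intro exI[of _ xs] exI[of _ rest]) (auto simp: n_def s2_def)
    moreover have "m - 1 < m"
      using m stk by simp
    ultimately show ?thesis
      unfolding run by blast
  qed
qed

text \<open>The disjunction records that the guard held at the previous value of \<open>k\<close>;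
  this later bounds the sample size from above. The case \<open>k = 0\<close> is separate because
  \<open>k - 1\<close> truncates.\<close>

definition count_inv :: "real \<Rightarrow> real \<Rightarrow> nat list list \<Rightarrow> nat \<Rightarrow> store \<Rightarrow> bool" where
  "count_inv \<epsilon> \<phi> ls m s \<longleftrightarrow> (\<exists>k\<le>length ls. m = length ls - k \<and>
     (k = 0 \<or> real (k - 1) * \<epsilon>\<^sup>2 < 2 * real (length ls) * \<phi>) \<and>
     s = (input_store ls)(''k'' := (\<lambda>_. 0)(0 := k)))"

lemma count_guard_iff:
  "s = (input_store ls)(''k'' := (\<lambda>_. 0)(0 := k)) \<Longrightarrow>
    bval (input_params \<epsilon> \<phi>) s count_guard \<longleftrightarrow>
      k < length ls \<and> real k * \<epsilon>\<^sup>2 < 2 * real (length ls) * \<phi>"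
  by (simp add: count_guard_def input_store_def input_params_def power2_eq_square)

lemma store_le_input_store:
  assumes "adjacency_lists n E ls" "\<And>e. e \<in> E \<Longrightarrow> e \<subseteq> {..<n}" "k \<le> length ls"
  shows "store_le ((input_store ls)(''k'' := (\<lambda>_. 0)(0 := k))) (size_bound ls)"
proof -
  have "concat ls ! i \<le> size_bound ls" if "i < length (concat ls)" for i
  proof -
    have "concat ls ! i \<in> set (concat ls)"
      using that by (rule nth_mem)
    then obtain v where "v < n" "{v, concat ls ! i} \<in> E"
      using assms(1) by (auto simp: adjacency_lists_def in_set_conv_nth[of _ ls])
    then have "concat ls ! i < length ls"
      using assms(1,2) by (fastforce simp: adjacency_lists_def)
    then show ?thesis
      by (simp add: size_bound_def)
  qed
  moreover have "length (concat (take i ls)) \<le> size_bound ls" for i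
  proof -
    have "length (concat (take i ls)) \<le> length (concat ls)"
      by (metis append_take_drop_id concat_append le_add1 length_append)
    then show ?thesis
      by (simp add: size_bound_def)
  qed
  moreover have "length ls \<le> size_bound ls"
    by (simp add: size_bound_def)
  ultimately show ?thesis
    using assms(3) by (auto simp: store_le_def input_store_def)
qed

lemma count_inv_step:
  assumes "count_inv \<epsilon> \<phi> ls m s" "bval (input_params \<epsilon> \<phi>) s count_guard"
  shows "\<exists>m'<m. count_inv \<epsilon> \<phi> ls m' (run p count_body s)"
proof -
  obtain k where k: "k \<le> length ls" "m = length ls - k"
    and s: "s = (input_store ls)(''k'' := (\<lambda>_. 0)(0 := k))"
    using assms(1) by (auto simp: count_inv_def)
  have guard: "k < length ls" "real k * \<epsilon>\<^sup>2 < 2 * real (length ls) * \<phi>"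
    using assms(2) by (simp_all add: count_guard_iff[OF s])
  have "run p count_body s = (input_store ls)(''k'' := (\<lambda>_. 0)(0 := Suc k))"
    by (simp add: count_body_def s)
  then have "count_inv \<epsilon> \<phi> ls (length ls - Suc k) (run p count_body s)"
    using guard unfolding count_inv_def by (intro exI[of _ "Suc k"]) auto
  then show ?thesis
    using k guard by (intro exI[of _ "length ls - Suc k"]) auto
qed

section \<open>The running time in terms of the number of edges\<close>

lemma length_concat_adjacency_lists:
  assumes "adjacency_lists n E ls" "finite E"
  shows "length (concat ls) \<le> 2 * card E"
proof -
  have "length (concat ls) = (\<Sum>v<n. card {u. {v, u} \<in> E})"
    using assms(1) by (auto simp: adjacency_lists_def length_concat sum_list_sum_nth atLeast0LessThan
        simp flip: distinct_card intro!: sum.cong)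
  also have "\<dots> = card (SIGMA v:{..<n}. {u. {v, u} \<in> E})"
    using assms(1) by (subst card_SigmaI) (auto simp: adjacency_lists_def, metis List.finite_set)
  \<comment> \<open>Double counting: the list entries are ordered pairs \<open>(v, u)\<close>, and
    at most two of them give the same edge.\<close>
  also have "\<dots> \<le> card (\<Union>e\<in>E. {(v, u). {v, u} = e})"
  proof (rule card_mono)
    have "finite {(v, u). {v, u} = e}" for e :: "nat set"
      by (rule finite_subset[of _ "{(v, u). v \<in> e \<and> u \<in> e \<and> finite e}"])
        (auto, cases "finite e", auto)
    then show "finite (\<Union>e\<in>E. {(v, u). {v, u} = e})"
      using assms(2) by blast
  qed auto
  also have "\<dots> \<le> (\<Sum>e\<in>E. card {(v, u). {v, u} = e})"
    using assms(2) by (rule card_UN_le)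
  also have "\<dots> \<le> (\<Sum>e\<in>E. 2)"
  proof (rule sum_mono)
    fix e :: "nat set"
    show "card {(v, u). {v, u} = e} \<le> 2"
    proof (cases "\<exists>a b. e = {a, b}")
      case True
      then obtain a b where "e = {a, b}"
        by blast
      then have eq: "{(v, u). {v, u} = e} = {(a, b), (b, a)}"
        by (auto simp: doubleton_eq_iff)
      show ?thesis
        unfolding eq using card_length[of "[(a, b), (b, a)]"] by simp
    next
      case False
      then have "{(v, u). {v, u} = e} = {}"
        by auto
      then show ?thesis
        by simp
    qed
  qed
  finally show ?thesis
    by simp
qed

text \<open>The shift by 2 keeps the logarithm at least 1, so it absorbs the additive constant 4 in
  the estimate.\<close>

lemma floorlog_size_bound:
  assumes "size_bound ls \<le> 3 * (m + 1)"
  shows "real (1 + floorlog 2 (size_bound ls)) \<le> 5 * log 2 (real m + 2)"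
proof -
  have "1 \<le> log 2 (real m + 2)"
    by (simp add: le_log_iff)
  have "0 < size_bound ls"
    by (simp add: size_bound_def)
  then have "real (floorlog 2 (size_bound ls)) \<le> log 2 (real (size_bound ls)) + 1"
    by (simp add: floorlog_def)
  also have "log 2 (real (size_bound ls)) \<le> log 2 (4 * (real m + 2))"
    using assms \<open>0 < size_bound ls\<close> by (subst log_le_cancel_iff) auto
  also have "\<dots> = 2 + log 2 (real m + 2)"
    using log_pow_cancel[of 2 2] by (subst log_mult) simp_all
  finally show ?thesis
    using \<open>1 \<le> log 2 (real m + 2)\<close> unfolding of_nat_add of_nat_1 by linarith
qed

lemma sample_prog_correct:
  "\<exists>C. \<forall>(\<epsilon>::real) \<phi> n E ls. 0 < \<epsilon> \<and> \<epsilon> < 1 \<and> 0 < \<phi> \<and> connected_graph {..<n} E \<and> adjacency_lists n E ls \<longrightarrow>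
    (\<exists>t s. exec (input_params \<epsilon> \<phi>) sample_prog (input_store ls) t s \<and>
      real t \<le> C * (real (card E) + 1) * log 2 (real (card E) + 2) ^ 1 \<and>
      edge_sample_set {..<n} E \<epsilon> \<phi> (output_set n s) \<and>
      min_theta_size 2 4 (real n * (\<phi> / \<epsilon>\<^sup>2)) n (card (output_set n s)))"
proof -
  have free: "loop_free count_body" "loop_free visit" "loop_free step_body"
    by (simp_all add: count_body_def visit_def step_body_def)
  obtain K1 where K1: "\<And>p I m s M. 0 < M \<Longrightarrow>
      (\<And>m s. I m s \<Longrightarrow> store_le s M \<and> (bval p s count_guard \<longrightarrow> (\<exists>m'<m. I m' (run p count_body s)))) \<Longrightarrow>
      I m s \<Longrightarrow> \<exists>t s' m'. exec p (Loop count_guard count_body) s t s' \<and>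
        t \<le> K1 * ((m + 1) * (1 + floorlog 2 M)) \<and> I m' s' \<and> \<not> bval p s' count_guard"
    using loop_free_Loop[OF free(1), of count_guard] by blast
  obtain K2 where K2: "\<And>p s M. store_le s M \<Longrightarrow> 0 < M \<Longrightarrow>
      \<exists>t\<le>K2 * (1 + floorlog 2 M). exec p visit s t (run p visit s)"
    using loop_free_exec[OF free(2)] by blast
  let ?guard = "NLess (NConst 0) (scalar ''sp'')"
  obtain K3 where K3: "\<And>p I m s M. 0 < M \<Longrightarrow>
      (\<And>m s. I m s \<Longrightarrow> store_le s M \<and> (bval p s ?guard \<longrightarrow> (\<exists>m'<m. I m' (run p step_body s)))) \<Longrightarrow>
      I m s \<Longrightarrow> \<exists>t s' m'. exec p (Loop ?guard step_body) s t s' \<and>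
        t \<le> K3 * ((m + 1) * (1 + floorlog 2 M)) \<and> I m' s' \<and> \<not> bval p s' ?guard"
    using loop_free_Loop[OF free(3), of ?guard] by blast
  define K where "K = K1 + K2 + K3"
  have "\<exists>t s. exec (input_params \<epsilon> \<phi>) sample_prog (input_store ls) t s \<and>
      real t \<le> 15 * real K * (real (card E) + 1) * log 2 (real (card E) + 2) ^ 1 \<and>
      edge_sample_set {..<n} E \<epsilon> \<phi> (output_set n s) \<and>
      min_theta_size 2 4 (real n * (\<phi> / \<epsilon>\<^sup>2)) n (card (output_set n s))"
    if eps: "0 < \<epsilon>" "\<epsilon> < 1" and phi: "0 < \<phi>" and graph: "connected_graph {..<n} E"
      and ls: "adjacency_lists n E ls"
    for \<epsilon> \<phi> :: real and n E ls
  proof -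
    let ?p = "input_params \<epsilon> \<phi>" and ?M = "size_bound ls"
    define L where "L = 1 + floorlog 2 ?M"
    have n: "length ls = n" "0 < n"
      using ls graph by (auto simp: adjacency_lists_def connected_graph_def)
    have M: "0 < ?M"
      by (simp add: size_bound_def)
    have edges: "\<And>e. e \<in> E \<Longrightarrow> e \<subseteq> {..<n}" and "finite E"
      using graph finite_subset[of E "Pow {..<n}"] by (auto simp: connected_graph_def)
    note store_le = store_le_input_store[OF ls edges]

    obtain t1 s1 m1 where t1: "exec ?p (Loop count_guard count_body) (input_store ls) t1 s1"
      "t1 \<le> K1 * ((n + 1) * L)" and s1: "count_inv \<epsilon> \<phi> ls m1 s1" "\<not> bval ?p s1 count_guard"
    proof (atomize_elim, unfold L_def, rule K1[OF M])
      fix m s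
      assume inv: "count_inv \<epsilon> \<phi> ls m s"
      then have "store_le s ?M"
        using store_le by (auto simp: count_inv_def)
      then show "store_le s ?M \<and> (bval ?p s count_guard \<longrightarrow> (\<exists>m'<m. count_inv \<epsilon> \<phi> ls m' (run ?p count_body s)))"
        using count_inv_step[OF inv] by blast
    next
      show "count_inv \<epsilon> \<phi> ls n (input_store ls)"
        unfolding count_inv_def n(1)
        by (intro exI[of _ 0]) (auto simp: input_store_def fun_eq_iff)
    qed
    obtain k where k: "k \<le> n" "k = 0 \<or> real (k - 1) * \<epsilon>\<^sup>2 < 2 * real n * \<phi>"
      and s1_eq: "s1 = (input_store ls)(''k'' := (\<lambda>_. 0)(0 := k))"
      using s1(1) n by (auto simp: count_inv_def)
    have guard: "k < n \<Longrightarrow> 2 * real n * \<phi> \<le> real k * \<epsilon>\<^sup>2"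
      using s1(2) n by (auto simp: count_guard_iff[OF s1_eq])
    \<comment> \<open>Positivity of \<open>\<phi>\<close> makes the guard true at
      \<open>k = 0\<close>, so the loop cannot stop there.\<close>
    have "0 < k"
      using guard n(2) phi by (cases "k = 0") (auto simp: mult_le_0_iff)
    have k': "k = 1 \<or> real (k - 1) * \<epsilon>\<^sup>2 < 2 * real n * \<phi>"
      using k(2) \<open>0 < k\<close> by auto

    have le1: "store_le s1 ?M"
      using store_le[of k] k(1) n by (simp add: s1_eq)
    obtain t2 where t2: "t2 \<le> K2 * L" "exec ?p visit s1 t2 (run ?p visit s1)"
      using K2[OF le1 M] unfolding L_def by blast
    have rep1: "represents ls k s1 [] []" "s1 ''u'' 0 = 0" "\<And>v. s1 ''pos'' v = 0"
      by (auto simp: represents_def s1_eq input_store_def)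
    note visit = run_visit[OF rep1(1) le1 rep1(2), of ?p]
    \<comment> \<open>Initially all lists are unscanned, \<open>n - 1\<close> vertices are unvisited
      and the root is alone on the stack.\<close>
    have "search_inv E ls k (length (concat ls) + n) (run ?p visit s1)"
    proof -
      have "(\<Sum>v<n. length (ls ! v)) = length (concat ls)"
        by (simp add: length_concat sum_list_sum_nth n atLeast0LessThan)
      then show ?thesis
        unfolding search_inv_def
        using visit k n dfs.start[of E 0] rep1(3)
        by (intro exI[of _ "[0]"]) (auto simp: size_bound_def)
    qed
    then obtain t3 s3 m3 where t3: "exec ?p (Loop ?guard step_body) (run ?p visit s1) t3 s3"
      "t3 \<le> K3 * ((length (concat ls) + n + 1) * L)"
      and s3: "search_inv E ls k m3 s3" "\<not> bval ?p s3 ?guard"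
    proof (atomize_elim, unfold L_def, intro K3[OF M])
      fix m s
      assume inv: "search_inv E ls k m s"
      then show "store_le s ?M \<and> (bval ?p s ?guard \<longrightarrow> (\<exists>m'<m. search_inv E ls k m' (run ?p step_body s)))"
        using search_inv_step[OF _ _ _ _ inv, of ?p] graph ls k(1) n by (auto simp: search_inv_def)
    qed
    \<comment> \<open>The loop ends with \<open>sp\<close> equal to 0, so the represented stack is
      empty and the search is complete.\<close>
    obtain xs where dfs: "dfs E 0 xs []" and out: "\<And>v. s3 ''out'' v = of_bool (v \<in> picked k n xs)"
      using s3 n by (auto simp: search_inv_def represents_def)
    note complete = dfs_complete[OF graph _ dfs]
    have len: "length xs = n"
      using complete(1,2) n distinct_card[of xs] by simp
    have "output_set n s3 = picked k n xs"
      using out picked_subset[of k n xs] complete(2) n by (auto simp: output_set_def)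
    moreover have "edge_sample_set {..<n} E \<epsilon> \<phi> (picked k n xs)"
      using edge_sample_set_picked[OF graph complete(1-3) eps \<open>0 < k\<close>] k(1) guard n by simp
    moreover have "min_theta_size 2 4 (real n * (\<phi> / \<epsilon>\<^sup>2)) n (card (picked k n xs))"
      using min_theta_size_ceiling[OF eps(1) k(1) guard k'] card_picked[of xs n k] complete(1) len k(1) n
      by simp
    moreover have "exec ?p sample_prog (input_store ls) (t1 + (t2 + t3)) s3"
      unfolding sample_prog_def by (intro exec.Seq[OF t1(1)] exec.Seq[OF t2(2)] t3(1))
    moreover have "real (t1 + (t2 + t3)) \<le> 15 * real K * (real (card E) + 1) * log 2 (real (card E) + 2) ^ 1"
    proof -
      have size: "length (concat ls) \<le> 2 * card E" "n \<le> card E + 1"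
        using length_concat_adjacency_lists[OF ls \<open>finite E\<close>] complete(4) n by auto
      \<comment> \<open>A common bound for both iteration counts: \<open>n + 1\<close> and
        \<open>length (concat ls) + n + 1\<close> are at most \<open>3 * card E + 2\<close>. With
        the factor 5 from \<open>floorlog_size_bound\<close> it gives 15.\<close>
      define S where "S = 3 * (card E + 1)"
      have "t1 \<le> K1 * (S * L)" "t2 \<le> K2 * (S * L)" "t3 \<le> K3 * (S * L)"
        using size by (auto simp: S_def intro!: order_trans[OF t1(2)] order_trans[OF t2(1)]
            order_trans[OF t3(2)] mult_le_mono)
      then have "t1 + (t2 + t3) \<le> K * S * L"
        by (simp add: K_def algebra_simps)
      then have "real (t1 + (t2 + t3)) \<le> real (K * S) * real L"
        by (metis of_nat_le_iff of_nat_mult)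
      also have "\<dots> \<le> real (K * S) * (5 * log 2 (real (card E) + 2))"
        using floorlog_size_bound[of ls "card E"] size n
        by (intro mult_left_mono) (auto simp: L_def size_bound_def)
      finally show ?thesis
        by (simp add: S_def algebra_simps)
    qed
    ultimately show ?thesis
      by metis
  qed
  then show ?thesis
    by blast
qed

theorem lemma4p2:
  shows "\<exists>c1 c2 :: real. c1 > 0 \<and> c2 > 0 \<and>
    (\<forall>(\<epsilon>::real) (\<phi>::real) (V :: 'a set) E.
       0 < \<epsilon> \<and> \<epsilon> < 1 \<and> 0 < \<phi> \<and> connected_graph V E \<longrightarrow>
       (\<exists>T. edge_sample_set V E \<epsilon> \<phi> T \<and>
            min_theta_size c1 c2 (real (card V) * (\<phi> / \<epsilon>\<^sup>2)) (card V) (card T))) \<and>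
    (\<exists>(alg :: prog) (C :: real) (d :: nat).
       \<forall>(\<epsilon>::real) (\<phi>::real) n E ls.
         0 < \<epsilon> \<and> \<epsilon> < 1 \<and> 0 < \<phi> \<and> connected_graph {..<n} E \<and> adjacency_lists n E ls \<longrightarrow>
         (\<exists>t s. exec (input_params \<epsilon> \<phi>) alg (input_store ls) t s \<and>
            real t \<le> C * (real (card E) + 1) * log 2 (real (card E) + 2) ^ d \<and>
            edge_sample_set {..<n} E \<epsilon> \<phi> (output_set n s) \<and>
            min_theta_size c1 c2 (real n * (\<phi> / \<epsilon>\<^sup>2)) n (card (output_set n s))))"
proof (rule exI[of _ 2], rule exI[of _ 4], intro conjI)
  show "\<forall>(\<epsilon>::real) (\<phi>::real) (V :: 'a set) E.
       0 < \<epsilon> \<and> \<epsilon> < 1 \<and> 0 < \<phi> \<and> connected_graph V E \<longrightarrow>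
       (\<exists>T. edge_sample_set V E \<epsilon> \<phi> T \<and>
            min_theta_size 2 4 (real (card V) * (\<phi> / \<epsilon>\<^sup>2)) (card V) (card T))"
    using ex_edge_sample_set by blast
  show "\<exists>(alg :: prog) (C :: real) (d :: nat).
       \<forall>(\<epsilon>::real) (\<phi>::real) n E ls.
         0 < \<epsilon> \<and> \<epsilon> < 1 \<and> 0 < \<phi> \<and> connected_graph {..<n} E \<and> adjacency_lists n E ls \<longrightarrow>
         (\<exists>t s. exec (input_params \<epsilon> \<phi>) alg (input_store ls) t s \<and>
            real t \<le> C * (real (card E) + 1) * log 2 (real (card E) + 2) ^ d \<and>
            edge_sample_set {..<n} E \<epsilon> \<phi> (output_set n s) \<and>
            min_theta_size 2 4 (real n * (\<phi> / \<epsilon>\<^sup>2)) n (card (output_set n s)))"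
    using sample_prog_correct by (rule exI[of _ sample_prog, OF exE]) blast
qed simp_all

end
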